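(* For every $\epsilon>0$ there is a non-clairvoyant online algorithm for minimizing total weighted flow-time plus total energy consumption on unrelated machines that is $(1+\epsilon)$-speed $O(1/\epsilon^2)$-competitive. This holds even when each machine $i$ has an arbitrary strictly convex power function $f_i:[0,\infty)\to[0,\infty)$ with $f_i(0)=0$.
   Context: Problem: there are $m$ machines and jobs arriving over time. Job $j$ has release time $r_j$, weight $w_j>0$, processing length $p_j>0$, and for each machine $i$ a rate $\ell_{ij}\ge 0$. At each time $t$ the scheduler chooses a speed $S(i,t)\ge 0$ for each machine $i$, paying energy at rate $f_i(S(i,t))$; each alive job is assigned to at most one machine at any instant, and machine $i$ splits $S(i,t)$ among the jobs $J_i(t)$ assigned to it as shares $\nu_j(t)\ge0$ with $\sum_{j\in J_i(t)}\nu_j(t)\le S(i,t)$; job $j\in J_i(t)$ is processed at rate $\ell_{ij}\nu_j(t)$. Preemption and migration are free. Job $j$ completes at the earliest time $C_j$ by which it has received $p_j$ units of processing; $F_j=C_j-r_j$. The objective is $\sum_j w_jF_j+\sum_i\int f_i(S(i,t))\,dt$. The online algorithm learns $w_j$ and the $\ell_{ij}$ at time $r_j$ but never learns $p_j$. The algorithm is $(1+\epsilon)$-speed $c$-competitive if, when it is allowed to run machine $i$ at speed $(1+\epsilon)s$ while paying only energy $f_i(s)$ (equivalently, the offline benchmark pays $f_i((1+\epsilon)s)$ for running at speed $s$), its objective is at most $c$ times the offline optimum on every instance. *)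

theory Defs
  imports "HOL-Analysis.Analysis" "HOL-Library.Landau_Symbols"
begin

text \<open>Machines are \<open>0, \<dots>, num_machines - 1\<close>.\<close>

record machines =
  num_machines :: nat
  power :: "nat \<Rightarrow> real \<Rightarrow> real"

definition strictly_convex_on :: "real set \<Rightarrow> (real \<Rightarrow> real) \<Rightarrow> bool" where
  "strictly_convex_on S f \<longleftrightarrow> convex S \<and>
     (\<forall>x\<in>S. \<forall>y\<in>S. \<forall>u. x \<noteq> y \<longrightarrow> 0 < u \<longrightarrow> u < 1 \<longrightarrow>
        f ((1 - u) * x + u * y) < (1 - u) * f x + u * f y)"

definition valid_machines :: "machines \<Rightarrow> bool" where
  "valid_machines M \<longleftrightarrow> (\<forall>i < num_machines M.
     (\<forall>s\<ge>0. power M i s \<ge> 0) \<and> power M i 0 = 0 \<and> strictly_convex_on {0..} (power M i))"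

text \<open>
  Jobs carry arbitrary natural numbers as names, so that the names of the jobs
  released so far carry no information about the jobs still to come.
  The rate at which job \<open>j\<close> is processed per unit of speed on machine \<open>i\<close> is
  \<open>rate I i j\<close>.
\<close>

record job_instance =
  jobs :: "nat set"
  release :: "nat \<Rightarrow> real"
  weight :: "nat \<Rightarrow> real"
  len :: "nat \<Rightarrow> real"
  rate :: "nat \<Rightarrow> nat \<Rightarrow> real"

definition valid_instance :: "machines \<Rightarrow> job_instance \<Rightarrow> bool" where
  "valid_instance M I \<longleftrightarrow> finite (jobs I) \<and>
     (\<forall>j\<in>jobs I. release I j \<ge> 0 \<and> weight I j > 0 \<and> len I j > 0 \<and>
        (\<forall>i < num_machines M. rate I i j \<ge> 0))"

text \<open>
  A decision fixes what happens at one instant. The value \<open>None\<close> of \<open>assigned\<close> means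
  that the job is on no machine; its \<open>share\<close> is then irrelevant.
\<close>

record decision =
  speed :: "nat \<Rightarrow> real"
  assigned :: "nat \<Rightarrow> nat option"
  share :: "nat \<Rightarrow> real"

type_synonym schedule = "real \<Rightarrow> decision"

definition processing_rate :: "job_instance \<Rightarrow> decision \<Rightarrow> nat \<Rightarrow> real" where
  "processing_rate I d j =
     (case assigned d j of None \<Rightarrow> 0 | Some i \<Rightarrow> rate I i j * share d j)"

definition processed :: "job_instance \<Rightarrow> schedule \<Rightarrow> nat \<Rightarrow> real \<Rightarrow> ennreal" where
  "processed I \<sigma> j t = (\<integral>\<^sup>+ s \<in> {0..t}. ennreal (processing_rate I (\<sigma> s) j) \<partial>lborel)"

text \<open>The completion time is infinite if the job never receives its full length.\<close>

definition completion :: "job_instance \<Rightarrow> schedule \<Rightarrow> nat \<Rightarrow> ennreal" where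
  "completion I \<sigma> j =
     Inf (ennreal ` {t. release I j \<le> t \<and> ennreal (len I j) \<le> processed I \<sigma> j t})"

definition flow_time :: "job_instance \<Rightarrow> schedule \<Rightarrow> nat \<Rightarrow> ennreal" where
  "flow_time I \<sigma> j = completion I \<sigma> j - ennreal (release I j)"

definition alive :: "job_instance \<Rightarrow> schedule \<Rightarrow> nat \<Rightarrow> real \<Rightarrow> bool" where
  "alive I \<sigma> j t \<longleftrightarrow> j \<in> jobs I \<and> release I j \<le> t \<and> ennreal t < completion I \<sigma> j"

text \<open>
  Under speed augmentation \<open>\<alpha>\<close>, a machine whose chosen (and paid) speed is \<open>s\<close>
  actually runs at speed \<open>\<alpha> * s\<close>; \<open>\<alpha> = 1\<close> is the unaugmented problem.
\<close>

definition feasible :: "real \<Rightarrow> machines \<Rightarrow> job_instance \<Rightarrow> schedule \<Rightarrow> bool" where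
  "feasible \<alpha> M I \<sigma> \<longleftrightarrow>
     (\<forall>i < num_machines M.
        (\<lambda>t. speed (\<sigma> t) i) \<in> borel_measurable (restrict_space borel {0..})) \<and>
     (\<forall>j \<in> jobs I.
        (\<lambda>t. assigned (\<sigma> t) j) \<in> measurable (restrict_space borel {0..}) (count_space UNIV) \<and>
        (\<lambda>t. share (\<sigma> t) j) \<in> borel_measurable (restrict_space borel {0..})) \<and>
     (\<forall>t\<ge>0.
        (\<forall>j \<in> jobs I. \<forall>i. assigned (\<sigma> t) j = Some i \<longrightarrow>
           i < num_machines M \<and> alive I \<sigma> j t \<and> share (\<sigma> t) j \<ge> 0) \<and>
        (\<forall>i < num_machines M. speed (\<sigma> t) i \<ge> 0 \<and>
           (\<Sum>j | j \<in> jobs I \<and> assigned (\<sigma> t) j = Some i. share (\<sigma> t) j)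
             \<le> \<alpha> * speed (\<sigma> t) i))"

definition cost :: "machines \<Rightarrow> job_instance \<Rightarrow> schedule \<Rightarrow> ennreal" where
  "cost M I \<sigma> =
     (\<Sum>j\<in>jobs I. ennreal (weight I j) * flow_time I \<sigma> j) +
     (\<Sum>i<num_machines M. \<integral>\<^sup>+ t \<in> {0..}. ennreal (power M i (speed (\<sigma> t) i)) \<partial>lborel)"

definition offline_opt :: "machines \<Rightarrow> job_instance \<Rightarrow> ennreal" where
  "offline_opt M I = (INF \<sigma> \<in> {\<sigma>. feasible 1 M I \<sigma>}. cost M I \<sigma>)"

text \<open>
  What a non-clairvoyant scheduler has seen by time \<open>t\<close>: for every job released by then, its
  release time, weight and rates, and, if it has already completed, its completion time. The
  lengths do not occur.
\<close>

record observation =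
  seen_release :: real
  seen_weight :: real
  seen_rate :: "nat \<Rightarrow> real"
  seen_completion :: "real option"

type_synonym history = "nat \<rightharpoonup> observation"

definition observed :: "machines \<Rightarrow> job_instance \<Rightarrow> schedule \<Rightarrow> real \<Rightarrow> history" where
  "observed M I \<sigma> t = (\<lambda>j.
     if j \<in> jobs I \<and> release I j \<le> t then
       Some \<lparr> seen_release = release I j,
              seen_weight = weight I j,
              seen_rate = (\<lambda>i. if i < num_machines M then rate I i j else 0),
              seen_completion =
                (if completion I \<sigma> j \<le> ennreal t then Some (enn2real (completion I \<sigma> j))
                 else None) \<rparr>
     else None)"

text \<open>
  A (deterministic) non-clairvoyant online algorithm knows the machines and their power
  functions and chooses its decision from the current time and the history. The algorithm's
  own past decisions need not be recorded, being determined by the history.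
\<close>

type_synonym nc_algorithm = "machines \<Rightarrow> real \<Rightarrow> history \<Rightarrow> decision"

definition run_of :: "nc_algorithm \<Rightarrow> machines \<Rightarrow> job_instance \<Rightarrow> schedule \<Rightarrow> bool" where
  "run_of A M I \<sigma> \<longleftrightarrow> (\<forall>t\<ge>0. \<sigma> t = A M t (observed M I \<sigma> t))"

text \<open>
  As the history depends on the schedule, a run is a solution of a fixed-point equation. A run
  must exist, and the guarantee is demanded of every run, so that no information about the
  lengths can enter through the choice of a solution.
\<close>

definition speed_competitive :: "nc_algorithm \<Rightarrow> real \<Rightarrow> real \<Rightarrow> bool" where
  "speed_competitive A \<alpha> c \<longleftrightarrow>
     (\<forall>M I. valid_machines M \<longrightarrow> valid_instance M I \<longrightarrow>
        (\<exists>\<sigma>. run_of A M I \<sigma>) \<and>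
        (\<forall>\<sigma>. run_of A M I \<sigma> \<longrightarrow>
           feasible \<alpha> M I \<sigma> \<and> cost M I \<sigma> \<le> ennreal c * offline_opt M I))"

end

theory Submission
  imports Defs "HOL-Real_Asymp.Real_Asymp"
begin

text \<open>
  Every machine queues its jobs and runs at the speed \<open>S(W)\<close> whose power equals the
  weight \<open>W\<close> it holds, so the energy of the algorithm equals its weighted flow time. A job whose
  prefix in the queue of machine \<open>i\<close> weighs \<open>P\<close> receives speed proportional to
  \<open>P\<^sup>n - (P - w)\<^sup>n\<close> for \<open>n\<close> about \<open>2/\<epsilon>\<close>, and has utility \<open>rate * S(P) / P\<close>. Jobs
  migrate selfishly to the tail of a queue that improves their utility; nobody else is harmed, so
  utilities never decrease over time, and a configuration of maximal total utility among those
  that dominate the previous one is a Nash equilibrium.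

  The analysis is a dual fitting. At every instant job \<open>j\<close> is charged \<open>\<alpha> \<le> w\<close>,
  proportional to its share and to \<open>P / S(P)\<close>; the charges sum to at least \<open>W / (n + 1)\<close>
  per machine. Equilibrium at time \<open>t\<close> and monotonicity of utilities bound the charges after
  \<open>t\<close> by the price \<open>(W + w) / S(W + w)\<close> at time \<open>t\<close> on any other machine. Integrating this
  against a competing schedule, a Young inequality for the power function turns prices times speeds
  into \<open>W / (n (1 + \<epsilon>))\<close> plus the cost of that schedule, and the gap
  \<open>1 / (n + 1) - 1 / (n (1 + \<epsilon>))\<close> is of order \<open>\<epsilon>\<^sup>2\<close>.
\<close>

section \<open>Power functions and their inverses\<close>

text \<open>Lengths are unknown, so no charge may depend on them. A charge at time s is instead
  bounded by a price fixed at an earlier time t times the algorithm's own processing rate of the job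
  at s, so its integral over s is at most price times length. Multiplying this bound by the rate of
  the competing schedule and integrating over t makes the length appear on both sides, and it
  cancels. The exponent n works through telescoping: differences of n-th prefix powers make the
  shares add up to the full speed, and those of degree n + 1 bound the charges from below. The loss
  factor n / (n + 1) tends to 1, so the speedup beats it for large n: n \<epsilon> \<ge> 2 gives n
  (1 + \<epsilon>) \<ge> n + 2, which leaves one unit after clearing denominators and a constant of
  order n (n + 1). Power functions may have kinks, so derivatives are avoided: star-shapedness, f (c
  x) \<le> c f x, carries the inequalities. A separate obstacle is that history and schedule
  determine each other, while completion times are infima that need not be attained. Runs are
  therefore built event by event.\<close>

locale power_function =
  fixes f :: "real \<Rightarrow> real"
  assumes nonneg: "0 \<le> s \<Longrightarrow> 0 \<le> f s"
    and zero [simp]: "f 0 = 0"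
    and strictly_convex: "strictly_convex_on {0..} f"
begin

text \<open>Convexity along the segment from 0, where \<open>f\<close> vanishes. Apart from
  positivity and continuity, all later inequalities use convexity in this form.\<close>

lemma star_shaped:
  assumes "0 \<le> c" "c \<le> 1" "0 \<le> x"
  shows "f (c * x) \<le> c * f x"
proof (cases "c = 0 \<or> c = 1 \<or> x = 0")
  case False
  then have c: "0 \<noteq> x" "0 < c" "c < 1" and x: "(0::real) \<in> {0..}" "x \<in> {0..}"
    using assms by auto
  from strictly_convex have "f ((1 - c) * 0 + c * x) < (1 - c) * f 0 + c * f x"
    unfolding strictly_convex_on_def using c x by blast
  then show ?thesis by simp
qed auto

lemma pos:
  assumes "0 < x" shows "0 < f x"
proof -
  have x: "(0::real) \<in> {0..}" "x \<in> {0..}" "0 \<noteq> x" "(0::real) < 1/2" "(1/2::real) < 1"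
    using assms by auto
  from strictly_convex have "f ((1 - 1/2) * 0 + 1/2 * x) < (1 - 1/2) * f 0 + 1/2 * f x"
    unfolding strictly_convex_on_def using x by blast
  moreover have "0 \<le> f ((1 - 1/2) * 0 + 1/2 * x)"
    using assms by (intro nonneg) auto
  ultimately show ?thesis by simp
qed

lemma strict_mono:
  assumes "0 \<le> x" "x < y" shows "f x < f y"
proof -
  have "f x = f (x / y * y)" using assms by simp
  also have "\<dots> \<le> x / y * f y" using assms by (intro star_shaped) auto
  also have "\<dots> < 1 * f y"
    using assms pos[of y] by (intro mult_strict_right_mono) auto
  finally show ?thesis by simp
qed

lemma mono:
  assumes "0 \<le> x" "x \<le> y" shows "f x \<le> f y"
  using strict_mono[of x y] assms by (cases "x = y") auto

lemma convex_on_nonneg: "convex_on {0..} f"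
proof (rule convex_onI)
  fix t x y :: real
  assume t: "0 < t" "t < 1" and xy: "x \<in> {0..}" "y \<in> {0..}"
  show "f ((1 - t) *\<^sub>R x + t *\<^sub>R y) \<le> (1 - t) * f x + t * f y"
  proof (cases "x = y")
    case False
    from strictly_convex have "f ((1 - t) * x + t * y) < (1 - t) * f x + t * f y"
      unfolding strictly_convex_on_def using t xy False by blast
    then show ?thesis by simp
  qed (auto simp: algebra_simps)
qed simp

text \<open>A convex function is continuous on the open half-line. At the end point 0 it is squeezed
  between 0 and the chord \<open>y * f 1\<close>.\<close>

lemma continuous: "continuous_on {0..} f"
  unfolding continuous_on_eq_continuous_within
proof
  fix x :: real assume "x \<in> {0..}"
  then consider "x = 0" | "x > 0" by fastforce
  then show "continuous (at x within {0..}) f"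
  proof cases
    case 1
    have upper: "((\<lambda>y. y * f 1) \<longlongrightarrow> 0) (at (0::real) within {0..})"
      by (rule tendsto_eq_intros | simp)+
    have near: "\<forall>\<^sub>F y::real in at 0 within {0..}. 0 \<le> y \<and> y \<le> 1"
      unfolding eventually_at by (rule exI[of _ 1]) (auto simp: dist_real_def)
    have bound: "f y \<le> y * f 1" if "0 \<le> y" "y \<le> 1" for y
      using star_shaped[of y 1] that by simp
    have "(f \<longlongrightarrow> 0) (at 0 within {0..})"
      by (rule tendsto_sandwich[OF _ _ tendsto_const upper])
        (use near in \<open>auto elim!: eventually_mono intro: nonneg bound\<close>)
    then show ?thesis using 1 by (simp add: continuous_within)
  next
    case 2
    have "convex_on {0<..} f"
      by (rule convex_on_subset[OF convex_on_nonneg]) auto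
    then have "continuous_on {0<..} f"
      by (rule convex_on_continuous[rotated]) auto
    then have "isCont f x"
      using 2 by (simp add: continuous_on_eq_continuous_at)
    then show ?thesis by (rule continuous_at_imp_continuous_at_within)
  qed
qed

lemma surjective:
  assumes "0 \<le> y" obtains s where "0 \<le> s" "f s = y"
proof -
  \<comment> \<open>By star-shapedness \<open>f b\<close> is at least \<open>b * f 1\<close>, which
    is \<open>y + f 1\<close>. The summand 1 makes \<open>b \<ge> 1\<close>, so that
    \<open>1 / b\<close> is an admissible scaling factor.\<close>
  define b where "b = y / f 1 + 1"
  have f1: "f 1 > 0" using pos[of 1] by simp
  have b: "b \<ge> 1" using assms f1 by (simp add: b_def)
  have "f 1 \<le> 1 / b * f b" using star_shaped[of "1 / b" b] b by simp
  then have "b * f 1 \<le> f b"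
    using b by (simp add: field_simps)
  moreover have "y \<le> b * f 1"
    using f1 unfolding b_def by (simp add: algebra_simps)
  ultimately have "y \<le> f b" by simp
  then have "\<exists>s. 0 \<le> s \<and> s \<le> b \<and> f s = y"
    using assms b by (intro IVT') (auto intro: continuous_on_subset[OF continuous])
  then show ?thesis using that by blast
qed

end

text \<open>The inverse of \<open>f\<close> on the nonnegative half-line. It stands outside the
  locale because the algorithm is a total function of the machines and must be definable before they
  are known to be valid.\<close>

definition speed_for :: "(real \<Rightarrow> real) \<Rightarrow> real \<Rightarrow> real" where
  "speed_for f y = (THE s. 0 \<le> s \<and> f s = y)"

section \<open>Speeds and prices derived from the inverse power function\<close>

context power_function
begin

lemma speed_for_unique:
  assumes "0 \<le> s" shows "speed_for f (f s) = s"
  unfolding speed_for_def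
proof (rule the_equality)
  fix s' assume "0 \<le> s' \<and> f s' = f s"
  then show "s' = s"
    using strict_mono[of s s'] strict_mono[of s' s] assms by (cases s s' rule: linorder_cases) auto
qed (use assms in auto)

lemma
  assumes "0 \<le> y"
  shows speed_for_nonneg: "0 \<le> speed_for f y" and f_speed_for: "f (speed_for f y) = y"
proof -
  obtain s where "0 \<le> s" "f s = y" using surjective[OF assms] .
  with speed_for_unique[of s] show "0 \<le> speed_for f y" "f (speed_for f y) = y" by auto
qed

lemma speed_for_zero [simp]: "speed_for f 0 = 0"
  using speed_for_unique[of 0] by simp

lemma speed_for_mono:
  assumes "0 \<le> x" "x \<le> y" shows "speed_for f x \<le> speed_for f y"
  using strict_mono[of "speed_for f y" "speed_for f x"] assms
    speed_for_nonneg[of y] f_speed_for[of x] f_speed_for[of y] by fastforce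

lemma speed_for_pos:
  assumes "0 < y" shows "0 < speed_for f y"
  using assms speed_for_nonneg[of y] f_speed_for[of y] zero
  by (metis less_eq_real_def order_less_irrefl)

text \<open>Star-shapedness of \<open>f\<close>, read through its inverse. It is the reason why a
  longer prefix means a lower utility and a higher price.\<close>

lemma speed_for_ratio_antimono:
  assumes "0 < x" "x \<le> y"
  shows "speed_for f y / y \<le> speed_for f x / x"
proof -
  let ?sx = "speed_for f x" and ?sy = "speed_for f y"
  have s: "0 < ?sx" "?sx \<le> ?sy" "0 < ?sy"
    using assms speed_for_pos speed_for_mono[of x y] by auto
  have "x = f (?sx / ?sy * ?sy)" using assms s f_speed_for[of x] by simp
  also have "\<dots> \<le> ?sx / ?sy * f ?sy"
    using s by (intro star_shaped) auto
  finally show ?thesis using assms s f_speed_for[of y] by (simp add: field_simps)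
qed

text \<open>Enlarging the argument of the increasing function \<open>speed_for\<close> only
  increases the denominators. This separates the weight of a queue from the weight of a job that
  considers joining it.\<close>

lemma ratio_subadditive:
  assumes "0 \<le> x" "0 \<le> y"
  shows "(x + y) / speed_for f (x + y) \<le> x / speed_for f x + y / speed_for f y"
proof (cases "x = 0 \<or> y = 0")
  case False
  have "x / speed_for f (x + y) \<le> x / speed_for f x" "y / speed_for f (x + y) \<le> y / speed_for f y"
    using assms False
    by (auto intro!: divide_left_mono speed_for_mono mult_pos_pos speed_for_pos)
  then show ?thesis by (simp add: add_divide_distrib)
qed auto

text \<open>The ratio on the left plays the role of a price per unit of speed; it is \<open>0 / 0 = 0\<close> at \<open>y = 0\<close>.\<close>

lemma ratio_times_speed_le:
  assumes "0 \<le> y" "0 \<le> s"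
  shows "y / speed_for f y * s \<le> y + f s"
proof (cases "y = 0")
  case False
  let ?u = "speed_for f y"
  have u: "0 < ?u" using speed_for_pos[of y] assms False by simp
  show ?thesis
  proof (cases "s \<le> ?u")
    case True
    have "y / ?u * s \<le> y / ?u * ?u" using u assms True by (intro mult_left_mono) auto
    then show ?thesis using u nonneg[of s] assms by simp
  next
    case False
    then have "f (?u / s * s) \<le> ?u / s * f s" using u assms by (intro star_shaped) auto
    then have "y / ?u * s \<le> f s"
      using u False f_speed_for[of y] assms by (simp add: field_simps)
    then show ?thesis using assms by simp
  qed
qed (use assms nonneg in auto)

text \<open>Superadditivity: each \<open>\<nu> j\<close> is a fraction of the total, and
  \<open>f\<close> shrinks at least by that fraction. It lets each job sharing a machine in the
  competing schedule be treated as if it ran on a machine of its own.\<close>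

lemma sum_le_of_sum:
  assumes "finite J" "\<And>j. j \<in> J \<Longrightarrow> 0 \<le> \<nu> j"
  shows "(\<Sum>j\<in>J. f (\<nu> j)) \<le> f (\<Sum>j\<in>J. \<nu> j)"
proof (cases "(\<Sum>j\<in>J. \<nu> j) = 0")
  case True
  then have "\<forall>j\<in>J. \<nu> j = 0" using assms by (simp add: sum_nonneg_eq_0_iff)
  then show ?thesis using True by simp
next
  case False
  let ?s = "\<Sum>j\<in>J. \<nu> j"
  have s: "0 < ?s" using False sum_nonneg[of J \<nu>] assms by fastforce
  have "(\<Sum>j\<in>J. f (\<nu> j)) \<le> (\<Sum>j\<in>J. \<nu> j / ?s * f ?s)"
  proof (rule sum_mono)
    fix j assume j: "j \<in> J"
    have "\<nu> j \<le> ?s" using assms j by (intro member_le_sum) auto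
    then have "f (\<nu> j / ?s * ?s) \<le> \<nu> j / ?s * f ?s"
      using s assms j by (intro star_shaped) auto
    then show "f (\<nu> j) \<le> \<nu> j / ?s * f ?s" using s by simp
  qed
  also have "\<dots> = f ?s"
    using s by (simp flip: sum_distrib_right sum_divide_distrib)
  finally show ?thesis .
qed

end

section \<open>Queues and equilibria\<close>

text \<open>\<open>a\<close> sends jobs to machines and \<open>k\<close> orders every queue, smaller
  keys in front. One global key replaces a list per machine. The job \<open>j\<close> itself belongs
  to its prefix.\<close>

definition prefix_weight :: "(nat \<Rightarrow> real) \<Rightarrow> (nat \<Rightarrow> nat) \<Rightarrow> (nat \<Rightarrow> nat) \<Rightarrow> nat set \<Rightarrow> nat \<Rightarrow> real" where
  "prefix_weight w a k A j = (\<Sum>x | x \<in> A \<and> a x = a j \<and> k x \<le> k j. w x)"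

definition load :: "(nat \<Rightarrow> real) \<Rightarrow> (nat \<Rightarrow> nat) \<Rightarrow> nat set \<Rightarrow> nat \<Rightarrow> real" where
  "load w a A i = (\<Sum>x | x \<in> A \<and> a x = i. w x)"

definition offer :: "(nat \<Rightarrow> real \<Rightarrow> real) \<Rightarrow> (nat \<Rightarrow> nat \<Rightarrow> real) \<Rightarrow> nat \<Rightarrow> nat \<Rightarrow> real \<Rightarrow> real" where
  "offer p l i j y = l i j * (speed_for (p i) y / y)"

definition utility where
  "utility p w l a k A j = offer p l (a j) j (prefix_weight w a k A j)"

definition queueing :: "nat \<Rightarrow> nat set \<Rightarrow> (nat \<Rightarrow> nat) \<Rightarrow> (nat \<Rightarrow> nat) \<Rightarrow> bool" where
  "queueing m A a k \<longleftrightarrow> inj_on k A \<and> (\<forall>j\<in>A. a j < m)"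

text \<open>A deviating job joins a tail and so sees the whole load plus its own weight. For the
  machine where it already is, its weight is counted twice; that instance is weaker than staying put
  and saves a case distinction.\<close>

definition equilibrium where
  "equilibrium m p w l A a k \<longleftrightarrow> queueing m A a k \<and>
     (\<forall>j\<in>A. \<forall>i<m. offer p l i j (load w a A i + w j) \<le> utility p w l a k A j)"

definition dominates where
  "dominates p w l A a k A' a' k' \<longleftrightarrow>
     (\<forall>j\<in>A \<inter> A'. utility p w l a k A j \<le> utility p w l a' k' A' j)"

lemma prefix_weight_ge:
  assumes "finite A" "\<forall>x\<in>A. w x > 0" "j \<in> A"
  shows "w j \<le> prefix_weight w a k A j"
  unfolding prefix_weight_def
  using assms by (intro member_le_sum) (auto intro: less_imp_le)

lemma prefix_weight_pos:
  assumes "finite A" "\<forall>x\<in>A. w x > 0" "j \<in> A"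
  shows "0 < prefix_weight w a k A j"
  using prefix_weight_ge[OF assms, of a k] assms by fastforce

lemma prefix_weight_le_load:
  assumes "finite A" "\<forall>x\<in>A. w x > 0"
  shows "prefix_weight w a k A j \<le> load w a A (a j)"
  unfolding prefix_weight_def load_def
  using assms by (intro sum_mono2) (auto intro: less_imp_le)

lemma load_nonneg:
  assumes "\<forall>x\<in>A. w x > 0" shows "0 \<le> load w a A i"
  unfolding load_def using assms by (intro sum_nonneg) (auto intro: less_imp_le)

lemma sum_load:
  assumes "finite A" "\<forall>x\<in>A. a x < m"
  shows "(\<Sum>i<m. load w a A i) = sum w A"
  unfolding load_def using assms by (intro sum.group) auto

lemma offer_antimono:
  assumes "power_function (p i)" "0 \<le> l i j" "0 < x" "x \<le> y"
  shows "offer p l i j y \<le> offer p l i j x"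
  unfolding offer_def using assms
  by (intro mult_left_mono power_function.speed_for_ratio_antimono)

lemma utility_mono:
  assumes "finite A'" "\<forall>x\<in>A'. w x > 0" "j \<in> A'" "power_function (p (a j))" "0 \<le> l (a j) j"
    and "a' j = a j" "prefix_weight w a' k' A' j \<le> prefix_weight w a k A j"
  shows "utility p w l a k A j \<le> utility p w l a' k' A' j"
  unfolding utility_def using assms
  by (auto intro!: offer_antimono prefix_weight_pos)

text \<open>Prefix weights only see the jobs in front, so joining at the tail of a queue harms nobody.\<close>

lemma move_to_tail:
  assumes fin: "finite A" and w: "\<forall>x\<in>A. w x > 0" and l: "\<forall>i<m. \<forall>x\<in>A. 0 \<le> l i x"
    and p: "\<forall>i<m. power_function (p i)" and q: "queueing m A a k" and j: "j \<in> A" and i: "i < m"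
  obtains a' k' where "queueing m A a' k'"
    "offer p l i j (load w a A i + w j) \<le> utility p w l a' k' A j"
    "\<And>x. x \<in> A \<Longrightarrow> x \<noteq> j \<Longrightarrow> utility p w l a k A x \<le> utility p w l a' k' A x"
proof
  let ?a = "a(j := i)" and ?k = "k(j := Suc (Max (k ` A)))"
  have less: "k x < Suc (Max (k ` A))" if "x \<in> A" for x
    using that fin by (simp add: le_imp_less_Suc)
  show "queueing m A ?a ?k"
    unfolding queueing_def
  proof
    have "Suc (Max (k ` A)) \<notin> k ` A" using less by force
    then show "inj_on ?k A" using q unfolding queueing_def by (simp add: inj_on_fun_updI)
  qed (use q i in \<open>simp add: queueing_def\<close>)
  have "prefix_weight w ?a ?k A j \<le> (\<Sum>x \<in> insert j {x \<in> A. a x = i}. w x)"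
    unfolding prefix_weight_def using fin w j
    by (intro sum_mono2) (auto intro: less_imp_le)
  also have "\<dots> \<le> load w a A i + w j"
    unfolding load_def using fin w j
    by (cases "a j = i") (auto simp: insert_absorb intro: less_imp_le)
  finally show "offer p l i j (load w a A i + w j) \<le> utility p w l ?a ?k A j"
    unfolding utility_def using fin w j l p i
    by (auto intro!: offer_antimono prefix_weight_pos)
  fix x assume x: "x \<in> A" "x \<noteq> j"
  have "{y \<in> A. ?a y = ?a x \<and> ?k y \<le> ?k x} \<subseteq> {y \<in> A. a y = a x \<and> k y \<le> k x}"
    using x less[of x] by auto
  then have "prefix_weight w ?a ?k A x \<le> prefix_weight w a k A x"
    unfolding prefix_weight_def using fin w by (intro sum_mono2) (auto intro: less_imp_le)
  then show "utility p w l a k A x \<le> utility p w l ?a ?k A x"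
    using fin w x l p q by (intro utility_mono) (auto simp: queueing_def)
qed

text \<open>Survivors keep their machine and order, and newcomers go behind them on machine 0.
  Departures can only shorten the prefixes of the survivors.\<close>

lemma dominating_queueing_exists:
  assumes fin: "finite A" "finite A'" and w: "\<forall>x\<in>A \<union> A'. w x > 0"
    and l: "\<forall>i<m. \<forall>x\<in>A'. 0 \<le> l i x" and p: "\<forall>i<m. power_function (p i)"
    and q: "queueing m A a k" and m: "0 < m"
  obtains a' k' where "queueing m A' a' k'" "dominates p w l A a k A' a' k'"
proof
  let ?a = "\<lambda>x. if x \<in> A then a x else 0"
  \<comment> \<open>Newcomers get keys above all old ones; adding the name \<open>x\<close> keeps
    the keys distinct.\<close>
  let ?k = "\<lambda>x. if x \<in> A then k x else Suc (Max (k ` A) + x)"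
  have less: "k x < Suc (Max (k ` A) + y)" if "x \<in> A" for x y
    using that fin by (simp add: le_imp_less_Suc trans_le_add1)
  show "queueing m A' ?a ?k"
    unfolding queueing_def
  proof
    show "inj_on ?k A'"
    proof (rule inj_onI)
      fix x y assume "?k x = ?k y"
      then show "x = y"
        using q less[of x y] less[of y x] unfolding queueing_def
        by (auto dest: inj_onD split: if_splits)
    qed
  qed (use q m in \<open>simp add: queueing_def\<close>)
  show "dominates p w l A a k A' ?a ?k"
    unfolding dominates_def
  proof
    fix x assume x: "x \<in> A \<inter> A'"
    have "{y \<in> A'. ?a y = ?a x \<and> ?k y \<le> ?k x} \<subseteq> {y \<in> A. a y = a x \<and> k y \<le> k x}"
    proof
      fix y assume y: "y \<in> {y \<in> A'. ?a y = ?a x \<and> ?k y \<le> ?k x}"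
      with x less[of x y] have "y \<in> A" by (auto split: if_splits)
      with x y show "y \<in> {y \<in> A. a y = a x \<and> k y \<le> k x}" by simp
    qed
    then have "prefix_weight w ?a ?k A' x \<le> prefix_weight w a k A x"
      unfolding prefix_weight_def using fin w by (intro sum_mono2) (auto intro: less_imp_le)
    then show "utility p w l a k A x \<le> utility p w l ?a ?k A' x"
      using fin w x l p q by (intro utility_mono) (auto simp: queueing_def)
  qed
qed

text \<open>There are infinitely many keys, but a utility depends only on the machine and on the set
  of jobs in the prefix, and both range over finite sets. This is what makes a maximal total utility
  exist.\<close>

lemma finite_total_utilities:
  assumes "finite A"
  shows "finite {\<Sum>j\<in>A. utility p w l a k A j | a k. \<forall>j\<in>A. a j < m}" (is "finite ?V")
proof -
  define val where "val j = (\<lambda>(i, B). offer p l i j (sum w B)) ` ({..<m} \<times> Pow A)" for j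
  have "utility p w l a k A j \<in> val j" if "a j < m" for a k j
    unfolding val_def utility_def prefix_weight_def using that
    by (intro image_eqI[of _ _ "(a j, {x. x \<in> A \<and> a x = a j \<and> k x \<le> k j})"]) auto
  then have "?V \<subseteq> (\<lambda>u. \<Sum>j\<in>A. u j) ` PiE A val"
    by (auto intro!: image_eqI[where x = "restrict (\<lambda>j. utility p w l a k A j) A" for a k])
  moreover have "finite ((\<lambda>u. \<Sum>j\<in>A. u j) ` PiE A val)"
    using assms by (intro finite_imageI finite_PiE) (auto simp: val_def)
  ultimately show ?thesis by (simp add: finite_subset)
qed

text \<open>Maximizing the total replaces a termination argument for sequences of migrations: a
  profitable move to a tail harms nobody, so the result still dominates the old configuration and
  has a larger total.\<close>

lemma dominating_equilibrium_exists:
  assumes fin: "finite A" "finite A'" and w: "\<forall>x\<in>A \<union> A'. w x > 0"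
    and l: "\<forall>i<m. \<forall>x\<in>A'. 0 \<le> l i x" and p: "\<forall>i<m. power_function (p i)"
    and q: "queueing m A a k" and m: "0 < m"
  shows "\<exists>a' k'. equilibrium m p w l A' a' k' \<and> dominates p w l A a k A' a' k'"
proof -
  define good where
    "good a' k' \<longleftrightarrow> queueing m A' a' k' \<and> dominates p w l A a k A' a' k'" for a' k'
  define total where "total a' k' = (\<Sum>j\<in>A'. utility p w l a' k' A' j)" for a' k'
  define V where "V = {total a' k' | a' k'. good a' k'}"
  have "V \<subseteq> {\<Sum>j\<in>A'. utility p w l a k A' j | a k. \<forall>j\<in>A'. a j < m}"
    unfolding V_def good_def total_def queueing_def by auto
  then have finV: "finite V"
    using finite_total_utilities[OF fin(2)] by (rule finite_subset)
  obtain a0 k0 where "good a0 k0"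
    using dominating_queueing_exists[OF fin w l p q m] unfolding good_def by metis
  then have "V \<noteq> {}" unfolding V_def by blast
  with finV have "Max V \<in> V" by simp
  then obtain a' k' where good: "good a' k'" and max: "Max V = total a' k'"
    unfolding V_def by blast
  have "offer p l i j (load w a' A' i + w j) \<le> utility p w l a' k' A' j"
    if j: "j \<in> A'" and i: "i < m" for i j
  proof (rule ccontr)
    assume gain: "\<not> ?thesis"
    have q': "queueing m A' a' k'" and w': "\<forall>x\<in>A'. w x > 0"
      using good w unfolding good_def by auto
    obtain a2 k2 where 2: "queueing m A' a2 k2"
      "offer p l i j (load w a' A' i + w j) \<le> utility p w l a2 k2 A' j"
      "\<And>x. x \<in> A' \<Longrightarrow> x \<noteq> j \<Longrightarrow> utility p w l a' k' A' x \<le> utility p w l a2 k2 A' x"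
      by (rule move_to_tail[OF fin(2) w' l p q' j i]) blast
    have up: "utility p w l a' k' A' x \<le> utility p w l a2 k2 A' x" if "x \<in> A'" for x
      using 2 gain that by (cases "x = j") auto
    then have "good a2 k2"
      using good 2 unfolding good_def dominates_def by (meson IntD2 order_trans)
    then have "total a2 k2 \<le> total a' k'"
      using finV max unfolding V_def by (metis (mono_tags, lifting) CollectI Max_ge)
    moreover have "total a' k' < total a2 k2"
      unfolding total_def using fin j up 2 gain by (intro sum_strict_mono_ex1) (auto intro!: bexI[of _ j])
    ultimately show False by simp
  qed
  then show ?thesis using good unfolding good_def equilibrium_def by blast
qed

lemma utility_cong:
  assumes "\<forall>x\<in>A. w x = w' x" "l (a j) j = l' (a j) j"
  shows "utility p w l a k A j = utility p w' l' a k A j"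
  unfolding utility_def offer_def prefix_weight_def using assms
  by (auto intro!: arg_cong[of _ _ "\<lambda>y. speed_for (p (a j)) y / y"] sum.cong)

lemma equilibrium_cong:
  assumes "\<forall>x\<in>A. w x = w' x" "\<forall>i<m. \<forall>x\<in>A. l i x = l' i x"
  shows "equilibrium m p w l A a k \<longleftrightarrow> equilibrium m p w' l' A a k"
proof -
  have load: "load w a A i = load w' a A i" for i
    unfolding load_def using assms by (intro sum.cong) auto
  have util: "utility p w l a k A j = utility p w' l' a k A j" if "j \<in> A" "a j < m" for j
    using assms that by (intro utility_cong) auto
  show ?thesis
    unfolding equilibrium_def queueing_def
    using assms util by (auto simp: load offer_def)
qed

section \<open>Telescoping sums along a queue and bounds for differences of powers\<close>

lemma sum_prefix_telescope:
  fixes g :: "real \<Rightarrow> real" and k :: "nat \<Rightarrow> nat"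
  assumes "finite B" "inj_on k B"
  shows "(\<Sum>j\<in>B. g (\<Sum>x | x \<in> B \<and> k x \<le> k j. w x) - g ((\<Sum>x | x \<in> B \<and> k x \<le> k j. w x) - w j))
    = g (sum w B) - g 0"
  using assms
proof (induction "card B" arbitrary: B)
  case 0
  then show ?case by simp
next
  case (Suc n)
  define P where "P B j = (\<Sum>x | x \<in> B \<and> k x \<le> k j. w x)" for B j
  have "k ` B \<noteq> {}" using Suc by auto
  then have "Max (k ` B) \<in> k ` B" using Suc by (intro Max_in) auto
  then obtain b where b: "b \<in> B" "k b = Max (k ` B)" by auto
  then have le: "k x \<le> k b" if "x \<in> B" for x using that Suc by simp
  let ?B = "B - {b}"
  have "P B b = sum w B"
    unfolding P_def using le by (auto intro!: sum.cong)
  moreover have "sum w B - w b = sum w ?B"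
    using b Suc by (simp add: sum_diff1)
  \<comment> \<open>The last job \<open>b\<close> is in nobody else's prefix, so removing it changes
    no other summand.\<close>
  moreover have "P B j = P ?B j" if "j \<in> ?B" for j
  proof -
    have "k j < k b" using that b le[of j] Suc.prems by (auto simp: inj_on_def order_le_less)
    then have "{x. x \<in> B \<and> k x \<le> k j} = {x. x \<in> ?B \<and> k x \<le> k j}" by auto
    then show ?thesis unfolding P_def by simp
  qed
  moreover have "(\<Sum>j\<in>?B. g (P ?B j) - g (P ?B j - w j)) = g (sum w ?B) - g 0"
    unfolding P_def using Suc b by (intro Suc) (auto intro: inj_on_subset)
  ultimately show ?case
    using b Suc.prems unfolding P_def[symmetric]
    by (simp add: sum.remove[of B b])
qed

text \<open>The prefix without its last job is the preceding prefix of the same queue. With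
  \<open>g\<close> the power \<open>n\<close> this adds up the shares, with the power
  \<open>Suc n\<close> the lower bounds of the charges.\<close>

lemma sum_queue_telescope:
  fixes g :: "real \<Rightarrow> real"
  assumes "finite A" "inj_on k A"
  shows "(\<Sum>j | j \<in> A \<and> a j = i. g (prefix_weight w a k A j) - g (prefix_weight w a k A j - w j))
    = g (load w a A i) - g 0"
proof -
  let ?B = "{j. j \<in> A \<and> a j = i}"
  have "prefix_weight w a k A j = (\<Sum>x | x \<in> ?B \<and> k x \<le> k j. w x)" if "j \<in> ?B" for j
    unfolding prefix_weight_def using that by (intro sum.cong) auto
  then show ?thesis
    unfolding load_def using sum_prefix_telescope[of ?B k g w] assms
    by (simp add: inj_on_def)
qed

text \<open>The mean value bound for the power \<open>n\<close>, multiplied by \<open>y\<close> so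
  that the exponent \<open>n - 1\<close> disappears. It will keep a charge below the weight of its
  job.\<close>

lemma power_diff_upper:
  fixes x y :: real
  assumes "0 \<le> x" "x \<le> y" "0 < n"
  shows "y * (y ^ n - x ^ n) \<le> real n * (y - x) * y ^ n"
proof -
  have "x ^ i * y ^ (n - Suc i) \<le> y ^ (n - 1)" if "i < n" for i
  proof -
    have "x ^ i * y ^ (n - Suc i) \<le> y ^ i * y ^ (n - Suc i)"
      using assms by (intro mult_right_mono power_mono) auto
    also have "\<dots> = y ^ (n - 1)" using that by (simp flip: power_add)
    finally show ?thesis .
  qed
  then have "(\<Sum>i<n. x ^ i * y ^ (n - Suc i)) \<le> real n * y ^ (n - 1)"
    using sum_bounded_above[of "{..<n}" "\<lambda>i. x ^ i * y ^ (n - Suc i)" "y ^ (n - 1)"] by simp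
  moreover have "y ^ n - x ^ n = (y - x) * (\<Sum>i<n. x ^ i * y ^ (n - Suc i))"
    using power_diff_sumr2[of y n x] sum.nat_diff_reindex[of "\<lambda>i. x ^ i * y ^ (n - Suc i)" n]
    by (simp add: mult.commute)
  ultimately have "y ^ n - x ^ n \<le> (y - x) * (real n * y ^ (n - 1))"
    using assms by (simp add: mult_left_mono)
  then have "y * (y ^ n - x ^ n) \<le> y * ((y - x) * (real n * y ^ (n - 1)))"
    using assms by (intro mult_left_mono) auto
  also have "\<dots> = real n * (y - x) * (y * y ^ (n - 1))" by (simp add: algebra_simps)
  also have "y * y ^ (n - 1) = y ^ n" using assms by (simp add: power_eq_if)
  finally show ?thesis .
qed

text \<open>As integrals from \<open>x\<close> to \<open>y\<close>, it compares
  \<open>n * (n + 1) * s ^ n\<close> with \<open>n * (n + 1) * y * s ^ (n - 1)\<close> for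
  \<open>s \<le> y\<close>. It trades the power differences in the charges for those of degree
  \<open>n + 1\<close>, which telescope.\<close>

lemma power_diff_lower:
  fixes x y :: real
  assumes "0 \<le> x" "x \<le> y"
  shows "real n * (y ^ Suc n - x ^ Suc n) \<le> real (Suc n) * (y * (y ^ n - x ^ n))"
proof (induction n)
  case (Suc n)
  let ?X = "x ^ Suc n" and ?Y = "y ^ Suc n"
  \<comment> \<open>This product is exactly the slack of the claim over \<open>x\<close> times the
    induction hypothesis.\<close>
  have "0 \<le> (y - x) * (?Y - ?X)"
    using assms by (intro mult_nonneg_nonneg) (auto intro: power_mono simp del: power_Suc)
  moreover have "x * (real n * (?Y - ?X)) \<le> x * (real (Suc n) * (y * (y ^ n - x ^ n)))"
    using Suc assms by (intro mult_left_mono) auto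
  ultimately show ?case by (simp add: algebra_simps)
qed simp

section \<open>Schedules and completion times\<close>

text \<open>Feasibility asks for measurability on nonnegative times only. Integrating over the
  restricted space makes those hypotheses directly applicable.\<close>

abbreviation time :: "real measure" where
  "time \<equiv> restrict_space lborel {0..}"

lemma measurable_time_iff:
  "f \<in> measurable (restrict_space borel {0..}) N \<longleftrightarrow> f \<in> measurable time N"
  by (intro arg_cong2[where f = "(\<in>)"] measurable_cong_sets refl sets_restrict_space_cong) simp

lemma nn_integral_time: "(\<integral>\<^sup>+ t. g t \<partial>time) = (\<integral>\<^sup>+ t \<in> {0..}. g t \<partial>lborel)"
  by (simp add: nn_integral_restrict_space)

lemma indicator_measurable_time:
  "B \<in> sets borel \<Longrightarrow> (indicator B :: real \<Rightarrow> ennreal) \<in> borel_measurable time"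
  by (intro measurable_restrict_space1) simp

lemma nn_integral_time_Icc:
  assumes "0 \<le> a"
  shows "(\<integral>\<^sup>+ t. ennreal c * indicator {a..<b} t \<partial>time) = ennreal c * ennreal (b - a)"
proof -
  have "(\<integral>\<^sup>+ t. ennreal c * indicator {a..<b} t \<partial>time) = (\<integral>\<^sup>+ t. ennreal c * indicator {a..<b} t \<partial>lborel)"
    unfolding nn_integral_time using assms
    by (intro nn_integral_cong) (auto split: split_indicator)
  also have "\<dots> = ennreal c * ennreal (b - a)"
    by (cases "a \<le> b") (simp_all add: nn_integral_cmult_indicator ennreal_neg)
  finally show ?thesis .
qed

lemma processed_time:
  "processed I \<sigma> j t = (\<integral>\<^sup>+ s. ennreal (processing_rate I (\<sigma> s) j) * indicator {..t} s \<partial>time)"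
  unfolding processed_def nn_integral_time
  by (intro nn_integral_cong) (auto split: split_indicator)

lemma completion_ge_release: "ennreal (release I j) \<le> completion I \<sigma> j"
  unfolding completion_def by (rule Inf_greatest) (auto intro: ennreal_leI)

lemma completion_le:
  assumes "release I j \<le> t" "ennreal (len I j) \<le> processed I \<sigma> j t"
  shows "completion I \<sigma> j \<le> ennreal t"
  unfolding completion_def using assms by (intro Inf_lower) auto

lemma completion_lessE:
  assumes "completion I \<sigma> j < x"
  obtains t where "release I j \<le> t" "ennreal (len I j) \<le> processed I \<sigma> j t" "ennreal t < x"
  using assms unfolding completion_def Inf_less_iff by auto

lemma processed_less_len:
  assumes "alive I \<sigma> j t" shows "processed I \<sigma> j t < ennreal (len I j)"
  using assms completion_le[of I j t \<sigma>] unfolding alive_def by (auto simp: not_le[symmetric])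

lemma processed_mono: "t \<le> t' \<Longrightarrow> processed I \<sigma> j t \<le> processed I \<sigma> j t'"
  unfolding processed_def by (intro nn_integral_mono) (auto split: split_indicator)

lemma processed_cong:
  assumes "\<And>s. 0 \<le> s \<Longrightarrow> s < t \<Longrightarrow> \<sigma> s = \<sigma>' s"
  shows "processed I \<sigma> j t = processed I \<sigma>' j t"
  unfolding processed_def
proof (rule nn_integral_cong_AE)
  \<comment> \<open>The schedules may differ at the end point \<open>t\<close>, which is a null
    set.\<close>
  show "AE s in lborel. ennreal (processing_rate I (\<sigma> s) j) * indicator {0..t} s =
      ennreal (processing_rate I (\<sigma>' s) j) * indicator {0..t} s"
    using AE_lborel_singleton[of t]
    by eventually_elim (use assms in \<open>auto split: split_indicator\<close>)
qed

text \<open>An infimum strictly below \<open>T\<close> has a witness below \<open>T\<close>, and the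
  work done by then depends only on decisions before \<open>T\<close>.\<close>

lemma completion_cong:
  assumes agree: "\<And>s. 0 \<le> s \<Longrightarrow> s < T \<Longrightarrow> \<sigma> s = \<sigma>' s"
    and r: "0 \<le> release I j" and C: "completion I \<sigma> j < ennreal T"
  shows "completion I \<sigma>' j = completion I \<sigma> j"
proof -
  have le: "completion I \<sigma>2 j \<le> completion I \<sigma>1 j"
    if "\<And>s. 0 \<le> s \<Longrightarrow> s < T \<Longrightarrow> \<sigma>1 s = \<sigma>2 s" "completion I \<sigma>1 j < ennreal T" for \<sigma>1 \<sigma>2
  proof (rule ccontr)
    assume "\<not> ?thesis"
    then have "completion I \<sigma>1 j < min (completion I \<sigma>2 j) (ennreal T)" using that by auto
    then obtain t where t: "release I j \<le> t" "ennreal (len I j) \<le> processed I \<sigma>1 j t"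
      "ennreal t < min (completion I \<sigma>2 j) (ennreal T)" by (rule completion_lessE)
    then have "t < T" using r by (simp add: ennreal_less_iff)
    then have "processed I \<sigma>1 j t = processed I \<sigma>2 j t" using that by (intro processed_cong) auto
    then have "completion I \<sigma>2 j \<le> ennreal t" using t by (intro completion_le) auto
    then show False using t by auto
  qed
  have "completion I \<sigma>' j \<le> completion I \<sigma> j" using agree C by (rule le)
  moreover from this C have "completion I \<sigma> j \<le> completion I \<sigma>' j"
    using agree by (intro le) auto
  ultimately show ?thesis by simp
qed

text \<open>
  For a schedule whose rates may be unbounded the infimum in the definition of the completion
  time need not be attained; a schedule that is constant from \<open>T\<close> on has no such problem at \<open>T\<close>.
\<close>

lemma len_le_processed_at:
  assumes const: "\<And>t. T \<le> t \<Longrightarrow> \<sigma> t = \<sigma> T" and T: "0 \<le> T"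
    and meas: "(\<lambda>t. processing_rate I (\<sigma> t) j) \<in> borel_measurable borel"
    and C: "completion I \<sigma> j \<le> ennreal T"
  shows "ennreal (len I j) \<le> processed I \<sigma> j T"
proof (rule ccontr)
  assume "\<not> ?thesis"
  then have less: "processed I \<sigma> j T < ennreal (len I j)" by simp
  define c where "c = max 0 (processing_rate I (\<sigma> T) j)"
  have [measurable]: "(\<lambda>t. processing_rate I (\<sigma> t) j) \<in> borel_measurable borel" by fact
  obtain p where p: "processed I \<sigma> j T = ennreal p" "0 \<le> p" "p < len I j"
    using less by (cases "processed I \<sigma> j T") (auto simp: ennreal_less_iff)
  \<comment> \<open>From \<open>T\<close> on the job gains at most \<open>c * \<delta>\<close> in
    time \<open>\<delta>\<close>, no more than half of what is missing at \<open>T\<close>. The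
    \<open>+ 1\<close> covers \<open>c = 0\<close>.\<close>
  define \<delta> where "\<delta> = (len I j - p) / (2 * (c + 1))"
  have "0 \<le> c" by (simp add: c_def)
  then have \<delta>: "0 < \<delta>" using p by (simp add: \<delta>_def)
  have "c * \<delta> = c / (c + 1) * ((len I j - p) / 2)"
    using \<open>0 \<le> c\<close> by (simp add: \<delta>_def divide_simps)
  also have "\<dots> \<le> 1 * ((len I j - p) / 2)"
    using \<open>0 \<le> c\<close> p by (intro mult_right_mono) auto
  finally have \<delta>_len: "p + c * \<delta> < len I j" using p by (simp add: field_simps)
  have rate_le: "processing_rate I (\<sigma> t) j \<le> c" if "T \<le> t" for t
    unfolding c_def by (subst const[OF that]) simp
  have bound: "processed I \<sigma> j t \<le> ennreal (p + c * (t - T))" if "T \<le> t" for t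
  proof -
    have "processed I \<sigma> j t \<le> (\<integral>\<^sup>+ s. (ennreal (processing_rate I (\<sigma> s) j) * indicator {0..T} s
        + ennreal c * indicator {T..t} s) \<partial>lborel)"
      unfolding processed_def using rate_le
      by (intro nn_integral_mono) (auto simp: ennreal_leI split: split_indicator)
    also have "\<dots> = processed I \<sigma> j T + (\<integral>\<^sup>+ s. ennreal c * indicator {T..t} s \<partial>lborel)"
      unfolding processed_def by (intro nn_integral_add) auto
    also have "\<dots> = ennreal p + ennreal c * ennreal (t - T)"
      using that p by (simp add: nn_integral_cmult_indicator)
    also have "\<dots> = ennreal (p + c * (t - T))"
      using that p by (simp add: c_def flip: ennreal_mult ennreal_plus)
    finally show ?thesis .
  qed
  have "completion I \<sigma> j < ennreal (T + \<delta>)"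
    using T \<delta> by (intro le_less_trans[OF C]) (simp add: ennreal_less_iff)
  then obtain t where t: "ennreal (len I j) \<le> processed I \<sigma> j t" "ennreal t < ennreal (T + \<delta>)"
    by (rule completion_lessE)
  then have "t < T + \<delta>" using ennreal_leI[of "T + \<delta>" t] by (auto simp: not_le[symmetric])
  have "processed I \<sigma> j t \<le> processed I \<sigma> j (T + \<delta>)"
    using \<open>t < T + \<delta>\<close> by (intro processed_mono) auto
  also have "\<dots> \<le> ennreal (p + c * \<delta>)" using bound[of "T + \<delta>"] \<delta> by simp
  also have "\<dots> < ennreal (len I j)" using \<delta>_len p by (intro ennreal_lessI) auto
  finally show False using t by simp
qed

text \<open>Extends \<open>completion_cong\<close> to completions exactly at \<open>T\<close>: there
  the full length has been processed by time \<open>T\<close>, a condition unaffected by the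
  decision at \<open>T\<close>. The run construction needs this because it changes that very
  decision.\<close>

lemma completion_cong_at:
  assumes agree: "\<And>s. 0 \<le> s \<Longrightarrow> s < T \<Longrightarrow> \<sigma> s = \<sigma>' s"
    and const: "\<And>t. T \<le> t \<Longrightarrow> \<sigma> t = \<sigma> T" and T: "0 \<le> T"
    and meas: "(\<lambda>t. processing_rate I (\<sigma> t) j) \<in> borel_measurable borel"
    and r: "0 \<le> release I j" and C: "completion I \<sigma> j \<le> ennreal T"
  shows "completion I \<sigma>' j = completion I \<sigma> j"
proof (cases "completion I \<sigma> j < ennreal T")
  case True
  with agree r show ?thesis by (rule completion_cong)
next
  case False
  have "ennreal (len I j) \<le> processed I \<sigma> j T"
    using const T meas C by (rule len_le_processed_at)
  also have "\<dots> = processed I \<sigma>' j T"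
    using agree by (rule processed_cong)
  finally have "ennreal (len I j) \<le> processed I \<sigma>' j T" .
  moreover have "release I j \<le> T"
    using order_trans[OF completion_ge_release[of I j \<sigma>] C] T by simp
  ultimately have "completion I \<sigma>' j \<le> ennreal T" by (intro completion_le)
  moreover have "\<not> completion I \<sigma>' j < ennreal T"
  proof
    assume *: "completion I \<sigma>' j < ennreal T"
    have "completion I \<sigma> j = completion I \<sigma>' j"
      using agree[symmetric] r * by (rule completion_cong)
    with * False show False by simp
  qed
  ultimately show ?thesis using False C by simp
qed

lemma observed_cong:
  assumes "\<And>j. j \<in> jobs I \<Longrightarrow> completion I \<sigma> j \<le> ennreal t \<or> completion I \<sigma>' j \<le> ennreal t \<Longrightarrow>
    completion I \<sigma>' j = completion I \<sigma> j"
  shows "observed M I \<sigma> t = observed M I \<sigma>' t"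
proof
  fix j show "observed M I \<sigma> t j = observed M I \<sigma>' t j"
    using assms[of j] unfolding observed_def by auto
qed

section \<open>Times at which the history can change\<close>

definition events :: "job_instance \<Rightarrow> schedule \<Rightarrow> real set" where
  "events I \<sigma> = release I ` jobs I \<union>
     (\<lambda>j. enn2real (completion I \<sigma> j)) ` {j \<in> jobs I. completion I \<sigma> j < top}"

lemma finite_events: "finite (jobs I) \<Longrightarrow> finite (events I \<sigma>)"
  unfolding events_def by auto

lemma completion_event:
  assumes "j \<in> jobs I" "completion I \<sigma> j \<le> ennreal s" "ennreal t < completion I \<sigma> j" "0 \<le> s"
  shows "enn2real (completion I \<sigma> j) \<in> events I \<sigma> \<inter> {t<..s}"
proof -
  from assms obtain c where c: "completion I \<sigma> j = ennreal c" "0 \<le> c"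
    by (cases "completion I \<sigma> j") (auto simp: top_unique)
  have "t < c" using assms c ennreal_leI[of c t] by (auto simp: not_le[symmetric])
  moreover have "c \<le> s" using assms c by simp
  moreover have "c \<in> events I \<sigma>"
    using assms c unfolding events_def by force
  ultimately show ?thesis using c by simp
qed

lemma observed_between_events:
  assumes "0 \<le> t" "t \<le> s" "events I \<sigma> \<inter> {t<..s} = {}"
  shows "observed M I \<sigma> s = observed M I \<sigma> t"
proof
  fix j
  have "release I j \<le> s \<longleftrightarrow> release I j \<le> t" if "j \<in> jobs I"
    using assms that unfolding events_def by force
  moreover have "completion I \<sigma> j \<le> ennreal s \<longleftrightarrow> completion I \<sigma> j \<le> ennreal t" if "j \<in> jobs I"
    using completion_event[OF that, of \<sigma> s t] assms
    by (metis empty_iff ennreal_leI leI order_trans)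
  ultimately show "observed M I \<sigma> s j = observed M I \<sigma> t j"
    unfolding observed_def by auto
qed

section \<open>Existence of runs\<close>

text \<open>The termination measure of the run construction: \<open>(j, True)\<close> is a release
  still to come, \<open>(j, False)\<close> a completion still to come. Jobs that never complete
  remain pending forever.\<close>

definition pending :: "job_instance \<Rightarrow> schedule \<Rightarrow> real \<Rightarrow> (nat \<times> bool) set" where
  "pending I \<sigma> T = {(j, b). j \<in> jobs I \<and>
     (if b then T < release I j else ennreal T < completion I \<sigma> j)}"

text \<open>The fixed point is built forward in time. A schedule that is correct before
  \<open>T\<close> gets a new constant decision from \<open>T\<close> on, computed from the history
  at \<open>T\<close>. As decisions depend only on the history, the equation then holds until the
  next event.\<close>

lemma run_extends:
  assumes stationary: "\<And>t t' H. A M t H = A M t' H"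
    and fin: "finite (jobs I)" and r: "\<And>j. j \<in> jobs I \<Longrightarrow> 0 \<le> release I j"
    and T: "0 \<le> T" and run: "\<And>t. 0 \<le> t \<Longrightarrow> t < T \<Longrightarrow> \<sigma> t = A M t (observed M I \<sigma> t)"
    and const: "\<And>t. T \<le> t \<Longrightarrow> \<sigma> t = \<sigma> T"
    and meas: "\<And>j. (\<lambda>t. processing_rate I (\<sigma> t) j) \<in> borel_measurable borel"
  shows "\<exists>\<sigma>. run_of A M I \<sigma>"
  using T run const meas
proof (induction "card (pending I \<sigma> T)" arbitrary: \<sigma> T rule: less_induct)
  case less
  \<comment> \<open>The new decision alters no completion up to \<open>T\<close>, so the history at
    \<open>T\<close> from which it was computed is also the history of the new schedule.\<close>
  define \<sigma>' where "\<sigma>' t = (if t < T then \<sigma> t else A M T (observed M I \<sigma> T))" for t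
  have const': "\<sigma>' t = \<sigma>' T" if "T \<le> t" for t using that by (simp add: \<sigma>'_def)
  have meas': "(\<lambda>t. processing_rate I (\<sigma>' t) j) \<in> borel_measurable borel" for j
  proof -
    have [measurable]: "(\<lambda>t. processing_rate I (\<sigma> t) j) \<in> borel_measurable borel"
      by (rule less.prems)
    have "(\<lambda>t. processing_rate I (\<sigma>' t) j) = (\<lambda>t. if t < T then processing_rate I (\<sigma> t) j
        else processing_rate I (A M T (observed M I \<sigma> T)) j)"
      by (auto simp: \<sigma>'_def)
    then show ?thesis by simp
  qed
  have same: "completion I \<sigma>' j = completion I \<sigma> j"
    if "j \<in> jobs I" "completion I \<sigma> j \<le> ennreal T \<or> completion I \<sigma>' j \<le> ennreal T" for j
    using that(2)
  proof
    assume "completion I \<sigma> j \<le> ennreal T"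
    then show ?thesis
      by (intro completion_cong_at[OF _ less.prems(3,1,4) r[OF that(1)]]) (auto simp: \<sigma>'_def)
  next
    assume *: "completion I \<sigma>' j \<le> ennreal T"
    have "completion I \<sigma> j = completion I \<sigma>' j"
      by (rule completion_cong_at[OF _ const' less.prems(1) meas' r[OF that(1)] *])
        (simp add: \<sigma>'_def)
    then show ?thesis by simp
  qed
  have obs: "observed M I \<sigma>' t = observed M I \<sigma> t" if "t \<le> T" for t
  proof (rule observed_cong[symmetric], rule same)
    fix j assume "completion I \<sigma> j \<le> ennreal t \<or> completion I \<sigma>' j \<le> ennreal t"
    then show "completion I \<sigma> j \<le> ennreal T \<or> completion I \<sigma>' j \<le> ennreal T"
      using ennreal_leI[OF that] by (auto intro: order_trans)
  qed
  have run': "\<sigma>' t = A M t (observed M I \<sigma>' t)"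
    if "0 \<le> t" "events I \<sigma>' \<inter> {T<..t} = {}" for t
  proof (cases "t < T")
    case True
    then show ?thesis using less.prems(2)[of t] that obs[of t] by (simp add: \<sigma>'_def)
  next
    case False
    then have "observed M I \<sigma>' t = observed M I \<sigma> T"
      using observed_between_events[of T t I \<sigma>' M] less.prems(1) that obs[of T] by simp
    moreover have "A M t (observed M I \<sigma> T) = A M T (observed M I \<sigma> T)"
      by (rule stationary)
    ultimately show ?thesis using False by (simp add: \<sigma>'_def)
  qed
  show ?case
  proof (cases "events I \<sigma>' \<inter> {T<..} = {}")
    case True
    then have "run_of A M I \<sigma>'"
      unfolding run_of_def by (intro allI impI run') auto
    then show ?thesis by (rule exI[of "run_of A M I" \<sigma>'])
  next
    case False
    let ?E = "events I \<sigma>' \<inter> {T<..}"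
    \<comment> \<open>The next event is taken under the new schedule, because the new decision
      determines when jobs complete after \<open>T\<close>.\<close>
    define T' where "T' = Min ?E"
    have finE: "finite ?E" using finite_events fin by blast
    have T': "T' \<in> events I \<sigma>'" "T < T'" using Min_in[OF finE False] unfolding T'_def by auto
    have first: "T' \<le> e" if "e \<in> ?E" for e using that finE unfolding T'_def by simp
    have finp: "finite (pending I \<sigma> T)"
      by (rule finite_subset[of _ "jobs I \<times> UNIV"]) (use fin in \<open>auto simp: pending_def\<close>)
    have same_less: "ennreal T < completion I \<sigma>' j \<longleftrightarrow> ennreal T < completion I \<sigma> j"
      if "j \<in> jobs I" for j using same[OF that] by (auto simp: not_le[symmetric])
    have "ennreal T < completion I \<sigma>' j" if "ennreal T' < completion I \<sigma>' j" for j
      using that T' by (meson ennreal_leI le_less_trans less_imp_le)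
    then have "pending I \<sigma>' T' \<subseteq> pending I \<sigma> T"
      unfolding pending_def using T' same_less by (auto split: if_splits)
    moreover have "pending I \<sigma>' T' \<noteq> pending I \<sigma> T"
    proof -
      from T'(1) consider j where "j \<in> jobs I" "T' = release I j"
        | j where "j \<in> jobs I" "completion I \<sigma>' j < top" "T' = enn2real (completion I \<sigma>' j)"
        unfolding events_def by auto
      then show ?thesis
      proof cases
        case 1
        then have "(j, True) \<in> pending I \<sigma> T - pending I \<sigma>' T'"
          using T' by (simp add: pending_def)
        then show ?thesis by blast
      next
        case 2
        then have C: "completion I \<sigma>' j = ennreal T'" by simp
        then have "ennreal T < completion I \<sigma>' j"
          using T' less.prems(1) by (simp add: ennreal_less_iff)
        then have "(j, False) \<in> pending I \<sigma> T - pending I \<sigma>' T'"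
          using C same_less[OF 2(1)] 2(1) by (simp add: pending_def)
        then show ?thesis by blast
      qed
    qed
    ultimately have "card (pending I \<sigma>' T') < card (pending I \<sigma> T)"
      by (intro psubset_card_mono finp psubsetI)
    then show ?thesis
    proof (rule less.hyps)
      show "0 \<le> T'" using T' less.prems(1) by simp
      show "\<sigma>' t = A M t (observed M I \<sigma>' t)" if "0 \<le> t" "t < T'" for t
      proof (rule run')
        have "e \<notin> events I \<sigma>'" if "T < e" "e \<le> t" for e
          using first[of e] that \<open>t < T'\<close> by auto
        then show "events I \<sigma>' \<inter> {T<..t} = {}" by auto
      qed (rule that)
      show "\<sigma>' t = \<sigma>' T'" if "T' \<le> t" for t
        using that T'(2) by (simp add: \<sigma>'_def)
    qed (rule meas')
  qed
qed

lemma run_exists: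
  assumes "\<And>t t' H. A M t H = A M t' H" "valid_instance M I"
  shows "\<exists>\<sigma>. run_of A M I \<sigma>"
  \<comment> \<open>Nothing is demanded before time 0, so any constant schedule starts the
    construction.\<close>
  using assms run_extends[of A M I 0 "\<lambda>_. undefined"] by (auto simp: valid_instance_def)

section \<open>Integral formulas\<close>

lemma alive_between:
  assumes "alive I \<sigma> j t" "release I j \<le> s" "s \<le> t" shows "alive I \<sigma> j s"
  using assms ennreal_leI[of s t] unfolding alive_def by (auto intro: le_less_trans)

lemma alive_before:
  assumes "alive I \<sigma> j s" "alive I \<sigma> j t" "s \<le> u" "u \<le> t" shows "alive I \<sigma> j u"
  using assms by (intro alive_between[of I \<sigma> j t u]) (auto simp: alive_def)

lemma alive_iff:
  assumes "j \<in> jobs I" "0 \<le> release I j"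
  shows "{t. alive I \<sigma> j t} =
    (if completion I \<sigma> j = top then {release I j..} else {release I j..<enn2real (completion I \<sigma> j)})"
proof (cases "completion I \<sigma> j")
  case (real c)
  then show ?thesis using assms by (auto simp: alive_def ennreal_less_iff)
qed (use assms in \<open>auto simp: alive_def\<close>)

lemma flow_time_eq:
  assumes "j \<in> jobs I" "0 \<le> release I j"
  shows "flow_time I \<sigma> j = (\<integral>\<^sup>+ t. indicator {t. alive I \<sigma> j t} t \<partial>time)"
proof -
  have "(\<integral>\<^sup>+ t. indicator {t. alive I \<sigma> j t} t \<partial>time) = (\<integral>\<^sup>+ t. indicator {t. alive I \<sigma> j t} t \<partial>lborel)"
    unfolding nn_integral_time using assms
    by (intro nn_integral_cong) (auto simp: alive_def split: split_indicator)
  also have "\<dots> = emeasure lborel {t. alive I \<sigma> j t}"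
    unfolding alive_iff[OF assms] by simp
  also have "\<dots> = flow_time I \<sigma> j"
  proof (cases "completion I \<sigma> j")
    case (real c)
    then have "release I j \<le> c"
      using completion_ge_release[of I j \<sigma>] by simp
    then show ?thesis
      unfolding alive_iff[OF assms] flow_time_def using real assms by (simp add: ennreal_minus)
  next
    case top
    have "emeasure lborel {release I j..} = top"
    proof (cases "emeasure lborel {release I j..}")
      case (real c)
      have "ennreal (c + 1) = emeasure lborel {release I j..release I j + (c + 1)}"
        using real(1) by (subst emeasure_lborel_Icc) auto
      also have "\<dots> \<le> ennreal c"
        unfolding real(2)[symmetric] by (intro emeasure_mono) auto
      finally show ?thesis using real(1) by simp
    qed
    then show ?thesis
      unfolding alive_iff[OF assms] flow_time_def using top by (simp add: ennreal_top_minus)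
  qed
  finally show ?thesis by simp
qed

lemma flow_time_ge:
  assumes "alive I \<sigma> j t" "0 \<le> release I j"
  shows "ennreal (t - release I j) \<le> flow_time I \<sigma> j"
  using assms unfolding flow_time_def alive_def
  by (auto simp flip: ennreal_minus intro!: ennreal_minus_mono)

text \<open>At every time when the job is alive its processed amount is below its length, but the
  completion time itself may be an infimum that is not attained. Hence the alive interval is
  exhausted from inside and the bound passes to the limit by monotone convergence.\<close>

lemma total_processed_le:
  assumes j: "j \<in> jobs I" "0 \<le> release I j"
    and meas: "(\<lambda>t. processing_rate I (\<sigma> t) j) \<in> borel_measurable time"
    and idle: "\<And>t. 0 \<le> t \<Longrightarrow> \<not> alive I \<sigma> j t \<Longrightarrow> processing_rate I (\<sigma> t) j \<le> 0"
  shows "(\<integral>\<^sup>+ t. ennreal (processing_rate I (\<sigma> t) j) \<partial>time) \<le> ennreal (len I j)"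
proof (cases "\<exists>t. alive I \<sigma> j t")
  case False
  then have "(\<integral>\<^sup>+ t. ennreal (processing_rate I (\<sigma> t) j) \<partial>time) = (\<integral>\<^sup>+ t. 0 \<partial>time)"
    using idle by (intro nn_integral_cong) (auto simp: space_restrict_space ennreal_neg)
  then show ?thesis by simp
next
  case True
  let ?r = "release I j" and ?\<rho> = "\<lambda>t. ennreal (processing_rate I (\<sigma> t) j)"
  have [measurable]: "(\<lambda>t. processing_rate I (\<sigma> t) j) \<in> borel_measurable time" by fact
  have alive_r: "alive I \<sigma> j ?r" using True j by (meson alive_between alive_def order_refl)
  \<comment> \<open>An increasing sequence of alive times that starts at the release and passes
    every other alive time, whether completion is finite or not.\<close>
  define x where "x n = (if completion I \<sigma> j = top then ?r + real n
      else let c = enn2real (completion I \<sigma> j) in c - (c - ?r) / (real n + 1))" for n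
  have r_less: "?r < enn2real (completion I \<sigma> j)" if "completion I \<sigma> j \<noteq> top"
    using alive_r j that by (cases "completion I \<sigma> j") (auto simp: alive_def ennreal_less_iff)
  have x_alive: "alive I \<sigma> j (x n)" for n
  proof -
    have "x n \<in> {t. alive I \<sigma> j t}"
      unfolding alive_iff[OF j] x_def using r_less by (auto simp: Let_def field_simps mult_left_mono)
    then show ?thesis by simp
  qed
  have "incseq x"
  proof (rule incseq_SucI)
    fix n show "x n \<le> x (Suc n)"
      unfolding x_def using r_less by (auto simp: Let_def intro!: divide_left_mono)
  qed
  have x_limit: "\<exists>n. t \<le> x n" if "alive I \<sigma> j t" for t
  proof (cases "completion I \<sigma> j = top")
    case True
    obtain n where "t - ?r \<le> real n" using real_arch_simple by blast
    then show ?thesis using True by (auto simp: x_def intro!: exI[of _ n])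
  next
    case False
    define c where "c = enn2real (completion I \<sigma> j)"
    have "t \<in> {t. alive I \<sigma> j t}" using that by simp
    then have t: "t < c" unfolding alive_iff[OF j] c_def using False by simp
    obtain n where "(c - ?r) / (c - t) \<le> real n" using real_arch_simple by blast
    then have "(c - ?r) / (real n + 1) \<le> c - t" using t by (simp add: field_simps)
    then show ?thesis using False by (auto simp: x_def Let_def c_def intro!: exI[of _ n])
  qed
  have "(\<integral>\<^sup>+ t. ?\<rho> t \<partial>time) \<le> (\<integral>\<^sup>+ t. (SUP n. ?\<rho> t * indicator {..x n} t) \<partial>time)"
  proof (rule nn_integral_mono)
    fix t assume t: "t \<in> space time"
    show "?\<rho> t \<le> (SUP n. ?\<rho> t * indicator {..x n} t)"
    proof (cases "alive I \<sigma> j t")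
      case True
      then obtain n where "t \<le> x n" using x_limit by blast
      then show ?thesis by (intro SUP_upper2[of n]) auto
    qed (use t idle in \<open>simp add: space_restrict_space ennreal_neg\<close>)
  qed
  also have "\<dots> = (SUP n. \<integral>\<^sup>+ t. ?\<rho> t * indicator {..x n} t \<partial>time)"
  proof (rule nn_integral_monotone_convergence_SUP)
    show "incseq (\<lambda>n t. ?\<rho> t * indicator {..x n} t)"
      using \<open>incseq x\<close> unfolding incseq_def le_fun_def
      by (auto intro: order_trans split: split_indicator)
    show "(\<lambda>t. ?\<rho> t * indicator {..x n} t) \<in> borel_measurable time" for n
      by (intro borel_measurable_times_ennreal indicator_measurable_time) auto
  qed
  also have "\<dots> \<le> ennreal (len I j)"
    using processed_less_len[OF x_alive] by (intro SUP_least) (auto simp: processed_time less_imp_le)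
  finally show ?thesis .
qed

section \<open>The algorithm\<close>

definition hist_weight :: "history \<Rightarrow> nat \<Rightarrow> real" where
  "hist_weight H j = (case H j of None \<Rightarrow> 0 | Some ob \<Rightarrow> seen_weight ob)"

definition hist_rate :: "history \<Rightarrow> nat \<Rightarrow> nat \<Rightarrow> real" where
  "hist_rate H i j = (case H j of None \<Rightarrow> 0 | Some ob \<Rightarrow> seen_rate ob i)"

definition hist_alive :: "history \<Rightarrow> nat set" where
  "hist_alive H = {j. \<exists>ob. H j = Some ob \<and> seen_completion ob = None}"

definition hist_times :: "history \<Rightarrow> real set" where
  "hist_times H = {e. \<exists>j ob. H j = Some ob \<and> (e = seen_release ob \<or> seen_completion ob = Some e)}"

definition hist_upto :: "history \<Rightarrow> real \<Rightarrow> history" where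
  "hist_upto H e j = (case H j of None \<Rightarrow> None
     | Some ob \<Rightarrow> if seen_release ob \<le> e then
         Some (ob\<lparr>seen_completion := (case seen_completion ob of None \<Rightarrow> None
           | Some c \<Rightarrow> if c \<le> e then Some c else None)\<rparr>)
       else None)"

type_synonym config = "nat set \<times> (nat \<Rightarrow> nat) \<times> (nat \<Rightarrow> nat)"

text \<open>The choice is arbitrary but fixed, so replaying the same history yields the same
  queues.\<close>

definition rebalance :: "machines \<Rightarrow> history \<Rightarrow> config \<Rightarrow> config" where
  "rebalance M H = (\<lambda>(A, a, k). (hist_alive H, SOME (a', k').
     equilibrium (num_machines M) (power M) (hist_weight H) (hist_rate H) (hist_alive H) a' k' \<and>
     dominates (power M) (hist_weight H) (hist_rate H) A a k (hist_alive H) a' k'))"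

text \<open>
  Having no memory, the algorithm replays all past events; truncating the history at each of them
  makes the replay reproduce its earlier configurations.
\<close>

definition configuration :: "machines \<Rightarrow> history \<Rightarrow> config" where
  "configuration M H = fold (\<lambda>e. rebalance M (hist_upto H e)) (sorted_list_of_set (hist_times H))
     ({}, \<lambda>_. 0, \<lambda>_. 0)"

text \<open>
  The shares are a smooth version of latest arrival processor sharing: for large \<open>n\<close> nearly
  all speed goes to the tail of the queue.
\<close>

definition migrate :: "real \<Rightarrow> nat \<Rightarrow> nc_algorithm" where
  "migrate \<eta> n M t H = (case configuration M H of (A, a, k) \<Rightarrow>
     let w = hist_weight H in
     \<lparr>speed = (\<lambda>i. speed_for (power M i) (load w a A i)),
      assigned = (\<lambda>j. if j \<in> A \<and> a j < num_machines M then Some (a j) else None),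
      share = (\<lambda>j. \<eta> * speed_for (power M (a j)) (load w a A (a j)) *
        ((prefix_weight w a k A j ^ n - (prefix_weight w a k A j - w j) ^ n) /
          load w a A (a j) ^ n))\<rparr>)"

lemma dominates_cong:
  assumes "\<forall>x\<in>A \<union> A'. w x = w' x" "\<forall>i<m. \<forall>x\<in>A \<union> A'. l i x = l' i x"
    and "queueing m A a k" "queueing m A' a' k'"
  shows "dominates p w l A a k A' a' k' \<longleftrightarrow> dominates p w' l' A a k A' a' k'"
proof -
  have "utility p w l a k A j = utility p w' l' a k A j"
    "utility p w l a' k' A' j = utility p w' l' a' k' A' j" if "j \<in> A \<inter> A'" for j
    using assms that by (auto intro!: utility_cong simp: queueing_def)
  then show ?thesis unfolding dominates_def by auto
qed

text \<open>\<open>\<sigma>\<close> is an arbitrary run, not the constructed one, since the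
  guarantee is demanded of all runs.\<close>

locale migration =
  fixes \<eta> :: real and n :: nat and M :: machines and I :: job_instance and \<sigma> :: schedule
  assumes machines: "valid_machines M" and "instance": "valid_instance M I"
    and run: "run_of (migrate \<eta> n) M I \<sigma>"
    and \<eta>_pos: "0 < \<eta>" and n_pos: "0 < n"
begin

abbreviation "m \<equiv> num_machines M"
abbreviation "p \<equiv> power M"
abbreviation "w \<equiv> weight I"
abbreviation "l \<equiv> rate I"
abbreviation "r \<equiv> release I"
abbreviation "obs \<equiv> observed M I \<sigma>"
abbreviation "E \<equiv> events I \<sigma>"

lemma power: "i < m \<Longrightarrow> power_function (p i)"
  using machines unfolding valid_machines_def power_function_def by auto

lemma finite_jobs [simp]: "finite (jobs I)"
  and r_nonneg: "j \<in> jobs I \<Longrightarrow> 0 \<le> r j"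
  and w_pos: "j \<in> jobs I \<Longrightarrow> 0 < w j"
  and len_pos: "j \<in> jobs I \<Longrightarrow> 0 < len I j"
  and l_nonneg: "j \<in> jobs I \<Longrightarrow> i < m \<Longrightarrow> 0 \<le> l i j"
  using "instance" unfolding valid_instance_def by auto

lemma finite_E [simp]: "finite E"
  by (rule finite_events) simp

lemma E_nonneg: "e \<in> E \<Longrightarrow> 0 \<le> e"
  unfolding events_def using r_nonneg by auto

section \<open>Replayed configurations and the monotonicity of utilities\<close>

definition Al :: "real \<Rightarrow> nat set" where "Al t = {j. alive I \<sigma> j t}"

lemma Al_jobs: "Al t \<subseteq> jobs I"
  unfolding Al_def alive_def by auto

lemma finite_Al [simp]: "finite (Al t)"
  using Al_jobs finite_jobs by (rule finite_subset)

lemma Al_w_pos: "\<forall>j\<in>Al t. 0 < w j"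
  using Al_jobs w_pos by blast

definition cfg :: "real \<Rightarrow> config" where
  "cfg t = fold (\<lambda>e. rebalance M (obs e)) (sorted_list_of_set (E \<inter> {..t})) ({}, \<lambda>_. 0, \<lambda>_. 0)"

definition asg :: "real \<Rightarrow> nat \<Rightarrow> nat" where "asg t = fst (snd (cfg t))"
definition key :: "real \<Rightarrow> nat \<Rightarrow> nat" where "key t = snd (snd (cfg t))"

definition util :: "real \<Rightarrow> nat \<Rightarrow> real" where
  "util t = utility p w l (asg t) (key t) (Al t)"

lemma hist_upto_obs:
  assumes "0 \<le> e" "e \<le> t" shows "hist_upto (obs t) e = obs e"
proof
  fix j
  show "hist_upto (obs t) e j = obs e j"
  proof (cases "completion I \<sigma> j")
    case (real c)
    then show ?thesis using assms unfolding hist_upto_def observed_def by auto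
  next
    case top
    then show ?thesis using assms unfolding hist_upto_def observed_def by (auto simp: top_unique)
  qed
qed

lemma hist_times_obs:
  assumes "0 \<le> t" shows "hist_times (obs t) = E \<inter> {..t}"
proof -
  have "completion I \<sigma> j \<le> ennreal t \<and> r j \<le> t \<longleftrightarrow>
      completion I \<sigma> j < top \<and> enn2real (completion I \<sigma> j) \<le> t" if "j \<in> jobs I" for j
    using completion_ge_release[of I j \<sigma>] assms r_nonneg[OF that]
    by (cases "completion I \<sigma> j") (auto simp: top_unique)
  then have "e \<in> hist_times (obs t) \<longleftrightarrow> e \<in> E \<inter> {..t}" for e
    unfolding hist_times_def observed_def events_def by (auto split: if_splits)
  then show ?thesis by blast
qed

lemma hist_alive_obs:
  assumes "0 \<le> t" shows "hist_alive (obs t) = Al t"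
  unfolding hist_alive_def observed_def Al_def alive_def by (auto simp: not_le)

lemma configuration_obs:
  assumes "0 \<le> t" shows "configuration M (obs t) = cfg t"
  unfolding configuration_def cfg_def hist_times_obs[OF assms]
  by (rule fold_cong) (use E_nonneg in \<open>auto simp: hist_upto_obs\<close>)

lemma hist_weight_obs: "j \<in> jobs I \<Longrightarrow> r j \<le> t \<Longrightarrow> hist_weight (obs t) j = w j"
  and hist_rate_obs: "j \<in> jobs I \<Longrightarrow> r j \<le> t \<Longrightarrow> i < m \<Longrightarrow> hist_rate (obs t) i j = l i j"
  unfolding hist_weight_def hist_rate_def observed_def by auto

lemma Al_before: "j \<in> Al s \<Longrightarrow> j \<in> Al t \<Longrightarrow> s \<le> u \<Longrightarrow> u \<le> t \<Longrightarrow> j \<in> Al u"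
  unfolding Al_def using alive_before by blast

lemma Al_earlier: "j \<in> Al t \<Longrightarrow> r j \<le> s \<Longrightarrow> s \<le> t \<Longrightarrow> j \<in> Al s"
  unfolding Al_def using alive_between by blast

lemma Al_negative: "t < 0 \<Longrightarrow> Al t = {}"
  unfolding Al_def alive_def using r_nonneg by force

lemma Al_const:
  assumes "s \<le> t" "E \<inter> {s<..t} = {}" shows "Al s = Al t"
proof (cases "0 \<le> t")
  case True
  have "r j \<le> s \<longleftrightarrow> r j \<le> t" if "j \<in> jobs I" for j
    using assms that unfolding events_def by force
  moreover have "ennreal s < completion I \<sigma> j \<longleftrightarrow> ennreal t < completion I \<sigma> j" if "j \<in> jobs I" for j
    using completion_event[OF that, of \<sigma> t s] assms True ennreal_leI[of s t]
    by (metis empty_iff le_less_trans not_le)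
  ultimately show ?thesis unfolding Al_def alive_def by auto
qed (use assms Al_negative in simp)

lemma cfg_const:
  assumes "s \<le> t" "E \<inter> {s<..t} = {}" shows "cfg s = cfg t"
proof -
  have "E \<inter> {..s} = E \<inter> {..t}" using assms by force
  then show ?thesis unfolding cfg_def by simp
qed

definition good :: "real \<Rightarrow> bool" where
  "good t \<longleftrightarrow> fst (cfg t) = Al t \<and> equilibrium m p w l (Al t) (asg t) (key t)"

lemma good_step:
  assumes m: "0 < m" and e: "e \<in> E" "s < e" "E \<inter> {s<..<e} = {}" and good: "good s"
  shows "good e \<and> (\<forall>j\<in>Al s \<inter> Al e. util s j \<le> util e j)"
proof -
  let ?H = "obs e" and ?B = "E \<inter> {..s}"
  have e0: "0 \<le> e" using E_nonneg e by simp
  have "E \<inter> {..e} = insert e ?B" using e by force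
  \<comment> \<open>\<open>e\<close> is later than all events up to \<open>s\<close>, so it
    contributes one final step of the fold.\<close>
  moreover have "sorted_list_of_set (insert e ?B) = sorted_list_of_set ?B @ [e]"
    using e by (intro sorted_list_of_set_unique[THEN iffD1]) 
       (auto simp: sorted_wrt_append strict_sorted_iff)
  ultimately have step: "cfg e = rebalance M ?H (cfg s)"
    unfolding cfg_def by simp
  have rel: "j \<in> jobs I \<and> r j \<le> e" if "j \<in> Al s \<union> Al e" for j
    using that e unfolding Al_def alive_def by auto
  have hw: "\<forall>j\<in>Al s \<union> Al e. hist_weight ?H j = w j"
    and hl: "\<forall>i<m. \<forall>j\<in>Al s \<union> Al e. hist_rate ?H i j = l i j"
    using rel by (auto simp: hist_weight_obs hist_rate_obs)
  have qs: "queueing m (Al s) (asg s) (key s)" and fs: "fst (cfg s) = Al s"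
    using good unfolding good_def equilibrium_def by auto
  let ?ok = "\<lambda>w l a' k'. equilibrium m p w l (Al e) a' k' \<and>
      dominates p w l (Al s) (asg s) (key s) (Al e) a' k'"
  have ok: "?ok (hist_weight ?H) (hist_rate ?H) a' k' \<longleftrightarrow> ?ok w l a' k'" for a' k'
  proof -
    have eq: "equilibrium m p (hist_weight ?H) (hist_rate ?H) (Al e) a' k' \<longleftrightarrow>
        equilibrium m p w l (Al e) a' k'"
      using hw hl by (intro equilibrium_cong) auto
    have "dominates p (hist_weight ?H) (hist_rate ?H) (Al s) (asg s) (key s) (Al e) a' k' \<longleftrightarrow>
        dominates p w l (Al s) (asg s) (key s) (Al e) a' k'" if "equilibrium m p w l (Al e) a' k'"
      using hw hl qs that unfolding equilibrium_def by (intro dominates_cong) auto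
    with eq show ?thesis by blast
  qed
  have "\<exists>a' k'. ?ok w l a' k'"
    using rel w_pos l_nonneg power m qs by (intro dominating_equilibrium_exists) auto
  then have ex: "\<exists>ak. case ak of (a', k') \<Rightarrow> ?ok (hist_weight ?H) (hist_rate ?H) a' k'"
    unfolding ok by auto
  have cfg_s: "cfg s = (Al s, asg s, key s)" by (simp add: asg_def key_def flip: fs)
  have cfg_e: "cfg e = (Al e, SOME (a', k'). ?ok (hist_weight ?H) (hist_rate ?H) a' k')"
    unfolding step rebalance_def cfg_s hist_alive_obs[OF e0] by simp
  then have "(asg e, key e) = (SOME (a', k'). ?ok (hist_weight ?H) (hist_rate ?H) a' k')"
    by (simp add: asg_def key_def)
  with someI_ex[OF ex] have "?ok w l (asg e) (key e)"
    unfolding ok by (metis (no_types, lifting) case_prod_conv)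
  then show ?thesis
    using cfg_e unfolding good_def dominates_def util_def by simp
qed

lemma good_propagates:
  assumes m: "0 < m" and "s \<le> t" "good s"
  shows "good t \<and> (\<forall>j\<in>Al s \<inter> Al t. util s j \<le> util t j)"
  using assms(2,3)
proof (induction "card (E \<inter> {s<..t})" arbitrary: t rule: less_induct)
  case less
  show ?case
  proof (cases "E \<inter> {s<..t} = {}")
    case True
    note cfg_const[OF less.prems(1) True] Al_const[OF less.prems(1) True]
    then show ?thesis using less.prems(2) unfolding good_def util_def asg_def key_def by simp
  next
    case False
    define e where "e = Max (E \<inter> {s<..t})"
    have e: "e \<in> E" "s < e" "e \<le> t" using Max_in[OF _ False] unfolding e_def by auto
    have last: "e' \<le> e" if "e' \<in> E" "s < e'" "e' \<le> t" for e'
      unfolding e_def using that by (intro Max_ge) auto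
    \<comment> \<open>\<open>u\<close> will be the last event before \<open>e\<close>, or
      \<open>s\<close> if there is none: the induction hypothesis reaches \<open>u\<close>, and one
      step leads from \<open>u\<close> to \<open>e\<close>.\<close>
    let ?B = "insert s (E \<inter> {s<..<e})"
    define u where "u = Max ?B"
    have u: "s \<le> u" "u < e" using e by (auto simp: u_def)
    have u_max: "e' \<le> u" if "e' \<in> ?B" for e' unfolding u_def using that by (intro Max_ge) auto
    have "e \<in> E \<inter> {s<..t}" "e \<notin> E \<inter> {s<..u}" "E \<inter> {s<..u} \<subseteq> E \<inter> {s<..t}"
      using e u by auto
    then have "E \<inter> {s<..u} \<subset> E \<inter> {s<..t}" by blast
    then have "card (E \<inter> {s<..u}) < card (E \<inter> {s<..t})" by (intro psubset_card_mono) auto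
    from less.hyps[OF this u(1)] less.prems
    have IH: "good u" "\<forall>j\<in>Al s \<inter> Al u. util s j \<le> util u j" by auto
    have "e' \<le> u" if "e' \<in> E" "u < e'" "e' < e" for e' using u_max[of e'] u that by auto
    then have "E \<inter> {u<..<e} = {}" by force
    from good_step[OF m e(1) u(2) this IH(1)]
    have step: "good e" "\<forall>j\<in>Al u \<inter> Al e. util u j \<le> util e j" by auto
    have "e' \<notin> {e<..t}" if "e' \<in> E" for e' using last[OF that] e(2) by auto
    then have "E \<inter> {e<..t} = {}" by blast
    note cfg_const[OF e(3) this] Al_const[OF e(3) this]
    then have "good t" and ut: "util t = util e"
      using step unfolding good_def util_def asg_def key_def by auto
    moreover have "util s j \<le> util t j" if "j \<in> Al s \<inter> Al t" for j
    proof -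
      have "j \<in> Al s" "j \<in> Al t" using that by auto
      moreover from this have "j \<in> Al u" "j \<in> Al e"
        using u e(2,3) by (auto intro: Al_before[of j s t])
      ultimately have "util s j \<le> util u j" "util u j \<le> util e j"
        using IH(2) step(2) by blast+
      then show ?thesis unfolding ut by simp
    qed
    ultimately show ?thesis by blast
  qed
qed

lemma good_always:
  assumes m: "0 < m" and t: "0 \<le> t" shows "good t"
proof -
  \<comment> \<open>Starting at the negative time -1, before every event, treats events at time 0
    like all others.\<close>
  have "E \<inter> {..-1} = {}" using E_nonneg by force
  then have "good (-1)"
    unfolding good_def asg_def key_def cfg_def
    by (simp add: Al_negative equilibrium_def queueing_def)
  then show ?thesis using good_propagates[OF m, of "-1" t] t by simp
qed

lemma util_mono:
  assumes "0 < m" "0 \<le> s" "s \<le> t" "j \<in> Al s" "j \<in> Al t"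
  shows "util s j \<le> util t j"
  using good_propagates[of s t] good_always[of s] assms by blast

text \<open>The history is constant between events, so a function of it factors through the set of
  past events, which takes finitely many values.\<close>

lemma measurable_determined:
  assumes det: "\<And>s t. 0 \<le> s \<Longrightarrow> 0 \<le> t \<Longrightarrow> obs s = obs t \<Longrightarrow> F s = F t"
    and sp: "\<And>t. 0 \<le> t \<Longrightarrow> F t \<in> space N"
  shows "F \<in> measurable time N"
proof -
  have nonneg: "0 \<le> Max (insert 0 X)" if "X \<subseteq> E" for X
    using that finite_subset[OF that] by (intro Max_ge) auto
  have "(\<lambda>t. E \<inter> {..t}) \<in> measurable time (count_space (Pow E))"
  proof (subst measurable_count_space_eq2)
    have "(\<lambda>t. E \<inter> {..t}) -` {X} \<inter> space time \<in> sets time" if "X \<in> Pow E" for X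
    proof -
      have "(\<lambda>t. E \<inter> {..t}) -` {X} \<inter> space time =
          {t \<in> space borel. \<forall>e\<in>E. (e \<in> X) = (e \<le> t)} \<inter> {0..}"
        using that by (auto simp: space_restrict_space)
      moreover have "{t \<in> space borel. \<forall>e\<in>E. (e \<in> X) = (e \<le> t)} \<in> sets (borel :: real measure)"
        by (rule sets.sets_Collect_finite_All) auto
      ultimately show ?thesis by (auto simp: sets_restrict_space)
    qed
    then show "(\<lambda>t. E \<inter> {..t}) \<in> space time \<rightarrow> Pow E \<and>
        (\<forall>X\<in>Pow E. (\<lambda>t. E \<inter> {..t}) -` {X} \<inter> space time \<in> sets time)" by auto
  qed simp
  moreover have "(\<lambda>X. F (Max (insert 0 X))) \<in> measurable (count_space (Pow E)) N"
    using nonneg sp by (simp add: measurable_count_space_eq1)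
  ultimately have factored: "(\<lambda>t. F (Max (insert 0 (E \<inter> {..t})))) \<in> measurable time N"
    by (rule measurable_compose)
  have "F t = F (Max (insert 0 (E \<inter> {..t})))" if "t \<in> space time" for t
  proof (rule det)
    let ?e = "Max (insert 0 (E \<inter> {..t}))"
    show "0 \<le> t" using that by (simp add: space_restrict_space)
    show "0 \<le> ?e" by (rule nonneg) auto
    have "?e \<le> t" using \<open>0 \<le> t\<close> by simp
    moreover have "E \<inter> {?e<..t} = {}"
    proof -
      have "e \<le> ?e" if "e \<in> E" "e \<le> t" for e using that by (intro Max_ge) auto
      then show ?thesis by force
    qed
    ultimately show "obs t = obs ?e"
      using \<open>0 \<le> ?e\<close> by (intro observed_between_events) auto
  qed
  then have "F \<in> measurable time N \<longleftrightarrow>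
      (\<lambda>t. F (Max (insert 0 (E \<inter> {..t})))) \<in> measurable time N"
    by (rule measurable_cong)
  with factored show ?thesis by blast
qed

section \<open>The schedule produced by the algorithm\<close>

definition W :: "real \<Rightarrow> nat \<Rightarrow> real" where
  "W t i = load w (asg t) (Al t) i"

definition P :: "real \<Rightarrow> nat \<Rightarrow> real" where
  "P t j = prefix_weight w (asg t) (key t) (Al t) j"

definition \<nu> :: "real \<Rightarrow> nat \<Rightarrow> real" where
  "\<nu> t j = \<eta> * speed_for (p (asg t j)) (W t (asg t j)) *
     ((P t j ^ n - (P t j - w j) ^ n) / W t (asg t j) ^ n)"

text \<open>The reciprocal of the factor that \<open>offer\<close> multiplies with the rate, so that
  comparisons of utilities become comparisons of prices.\<close>

definition price :: "nat \<Rightarrow> real \<Rightarrow> real" where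
  "price i y = y / speed_for (p i) y"

text \<open>The divisor \<open>\<eta>\<close> removes the speedup contained in the share, and
  \<open>n\<close> is the factor of the mean value bound, which makes the weight an upper
  bound.\<close>

definition \<alpha> :: "real \<Rightarrow> nat \<Rightarrow> real" where
  "\<alpha> t j = (if j \<in> Al t then \<nu> t j * price (asg t j) (P t j) / (real n * \<eta>) else 0)"

definition total :: "real \<Rightarrow> real" where
  "total t = (\<Sum>j\<in>Al t. w j)"

lemma \<sigma>_eq: "0 \<le> t \<Longrightarrow> \<sigma> t = migrate \<eta> n M 0 (obs t)"
  using run unfolding run_of_def migrate_def by simp

lemma Al_hist_weight: "\<forall>j\<in>Al t. hist_weight (obs t) j = w j"
  unfolding Al_def alive_def by (auto simp: hist_weight_obs)

lemma W_hist: "W t i = load (hist_weight (obs t)) (asg t) (Al t) i"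
  unfolding W_def load_def using Al_hist_weight by (intro sum.cong) auto

lemma P_hist: "P t j = prefix_weight (hist_weight (obs t)) (asg t) (key t) (Al t) j"
  unfolding P_def prefix_weight_def using Al_hist_weight by (intro sum.cong) auto

lemma measurable_of_config:
  fixes g :: "config \<Rightarrow> nat set \<Rightarrow> real"
  shows "(\<lambda>t. g (cfg t) (Al t)) \<in> borel_measurable time"
proof (rule measurable_determined)
  fix s t :: real assume "0 \<le> s" "0 \<le> t" "obs s = obs t"
  then have "cfg s = cfg t" "Al s = Al t"
    by (metis configuration_obs, metis hist_alive_obs)
  then show "g (cfg s) (Al s) = g (cfg t) (Al t)" by simp
qed simp

lemma W_measurable [measurable]: "(\<lambda>t. W t i) \<in> borel_measurable time"
  using measurable_of_config[of "\<lambda>c A. load w (fst (snd c)) A i"]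
  unfolding W_def asg_def .

lemma total_measurable [measurable]: "total \<in> borel_measurable time"
  using measurable_of_config[of "\<lambda>_ A. sum w A"] unfolding total_def[abs_def] .

lemma \<alpha>_measurable [measurable]: "(\<lambda>t. \<alpha> t j) \<in> borel_measurable time"
  unfolding \<alpha>_def \<nu>_def P_def W_def asg_def key_def
  by (rule measurable_of_config[of "\<lambda>c A. if j \<in> A then \<eta> * speed_for (p (fst (snd c) j))
      (load w (fst (snd c)) A (fst (snd c) j)) *
      ((prefix_weight w (fst (snd c)) (snd (snd c)) A j ^ n -
        (prefix_weight w (fst (snd c)) (snd (snd c)) A j - w j) ^ n) /
      load w (fst (snd c)) A (fst (snd c) j) ^ n) *
      price (fst (snd c) j) (prefix_weight w (fst (snd c)) (snd (snd c)) A j) / (real n * \<eta>)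
      else 0"])

lemma price_measurable [measurable]: "(\<lambda>t. price i (W t i + c)) \<in> borel_measurable time"
  using measurable_of_config[of "\<lambda>c' A. price i (load w (fst (snd c')) A i + c)"]
  unfolding W_def asg_def .

lemma W_nonneg: "0 \<le> W t i"
  unfolding W_def by (rule load_nonneg[OF Al_w_pos])

lemma price_nonneg:
  assumes "i < m" "0 \<le> y" shows "0 \<le> price i y"
  unfolding price_def using assms power_function.speed_for_nonneg[OF power] by simp

lemma total_nonneg: "0 \<le> total t"
  unfolding total_def using Al_w_pos by (intro sum_nonneg) (auto intro: less_imp_le)

lemma total_le: "total t \<le> sum w (jobs I)"
  unfolding total_def using Al_jobs w_pos
  by (intro sum_mono2) (auto intro: less_imp_le)

section \<open>Shares and charges at one instant\<close>

context
  assumes m: "0 < m"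
begin

context
  fixes t :: real
  assumes t: "0 \<le> t"
begin

lemma good: "good t"
  using good_always[OF m t] .

lemma asg_less: "j \<in> Al t \<Longrightarrow> asg t j < m"
  and inj_key: "inj_on (key t) (Al t)"
  using good unfolding good_def equilibrium_def queueing_def by auto

lemma cfg_eq: "cfg t = (Al t, asg t, key t)"
  using good unfolding good_def asg_def key_def by (simp add: prod_eq_iff)

lemma speed_eq: "speed (\<sigma> t) i = speed_for (p i) (W t i)"
  unfolding \<sigma>_eq[OF t] migrate_def configuration_obs[OF t] cfg_eq W_hist by (simp add: Let_def)

lemma assigned_eq: "assigned (\<sigma> t) j = (if j \<in> Al t then Some (asg t j) else None)"
  unfolding \<sigma>_eq[OF t] migrate_def configuration_obs[OF t] cfg_eq
  using asg_less by (simp add: Let_def)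

lemma share_eq: "j \<in> Al t \<Longrightarrow> share (\<sigma> t) j = \<nu> t j"
  using Al_hist_weight
  unfolding \<sigma>_eq[OF t] migrate_def configuration_obs[OF t] cfg_eq \<nu>_def W_hist P_hist
  by (simp add: Let_def)

lemma processing_rate_eq:
  "processing_rate I (\<sigma> t) j = (if j \<in> Al t then l (asg t j) j * \<nu> t j else 0)"
  unfolding processing_rate_def assigned_eq by (simp add: share_eq)

lemma sum_W: "(\<Sum>i<m. W t i) = total t"
  unfolding W_def total_def using asg_less by (intro sum_load) auto

lemma sum_over_queues:
  "(\<Sum>j\<in>Al t. g j) = (\<Sum>i<m. \<Sum>j | j \<in> Al t \<and> asg t j = i. g j)" for g :: "nat \<Rightarrow> real"
  using asg_less by (intro sum.group[symmetric]) auto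

context
  fixes j :: nat
  assumes j: "j \<in> Al t"
begin

lemma P_bounds: "w j \<le> P t j" "P t j \<le> W t (asg t j)" "0 < w j"
  unfolding P_def W_def
  using prefix_weight_ge[OF finite_Al Al_w_pos j] prefix_weight_le_load[OF finite_Al Al_w_pos]
    Al_w_pos j by auto

lemma P_pos: "0 < P t j" and W_pos: "0 < W t (asg t j)"
  using P_bounds by auto

lemma power_diff_nonneg: "0 \<le> P t j ^ n - (P t j - w j) ^ n"
  using P_bounds by (auto intro!: power_mono)

interpretation f: power_function "p (asg t j)"
  by (rule power[OF asg_less[OF j]])

lemma \<nu>_nonneg: "0 \<le> \<nu> t j"
  unfolding \<nu>_def using f.speed_for_nonneg[of "W t (asg t j)"] W_pos power_diff_nonneg \<eta>_pos
  by (intro mult_nonneg_nonneg divide_nonneg_nonneg) auto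

lemma speed_pos: "0 < speed_for (p (asg t j)) (P t j)" "0 < speed_for (p (asg t j)) (W t (asg t j))"
  using P_pos W_pos by (auto intro: f.speed_for_pos)

lemma \<alpha>_eq:
  "\<alpha> t j = speed_for (p (asg t j)) (W t (asg t j)) / speed_for (p (asg t j)) (P t j) *
    (P t j * (P t j ^ n - (P t j - w j) ^ n)) / (real n * W t (asg t j) ^ n)"
  using j \<eta>_pos by (simp add: \<alpha>_def \<nu>_def price_def mult_ac)

text \<open>Speed per weight decreases, so the ratio of the speeds at \<open>W\<close> and
  \<open>P\<close> is at most \<open>W / P\<close>. The mean value bound supplies
  \<open>n * w\<close> times a power of \<open>P\<close>, and \<open>P\<close> is at most
  \<open>W\<close>.\<close>

lemma \<alpha>_le_w: "\<alpha> t j \<le> w j"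
proof -
  let ?W = "W t (asg t j)" and ?S = "speed_for (p (asg t j))"
  have "?S ?W / ?S (P t j) \<le> ?W / P t j"
    using f.speed_for_ratio_antimono[of "P t j" ?W] P_pos W_pos speed_pos P_bounds
    by (simp add: field_simps)
  moreover have "P t j * (P t j ^ n - (P t j - w j) ^ n) \<le> real n * w j * P t j ^ n"
    using power_diff_upper[of "P t j - w j" "P t j" n] P_bounds n_pos by simp
  moreover have "0 \<le> ?W / P t j" "0 \<le> P t j * (P t j ^ n - (P t j - w j) ^ n)"
    using P_pos W_pos power_diff_nonneg by (simp, intro mult_nonneg_nonneg) auto
  ultimately have "?S ?W / ?S (P t j) * (P t j * (P t j ^ n - (P t j - w j) ^ n)) \<le>
      ?W / P t j * (real n * w j * P t j ^ n)"
    by (rule mult_mono)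
  also have "\<dots> = real n * w j * (?W * P t j ^ (n - 1))"
    using P_pos n_pos by (simp add: power_eq_if)
  also have "\<dots> \<le> real n * w j * (?W * ?W ^ (n - 1))"
    using P_pos P_bounds W_pos by (intro mult_left_mono power_mono) auto
  also have "\<dots> = w j * (real n * ?W ^ n)"
    using n_pos by (simp add: power_eq_if)
  finally show ?thesis
    unfolding \<alpha>_eq using W_pos n_pos by (intro mult_imp_div_pos_le) auto
qed

text \<open>Here the ratio of speeds is bounded below by 1, which leaves a difference of powers to
  which \<open>power_diff_lower\<close> applies.\<close>

lemma \<alpha>_ge:
  "(P t j ^ Suc n - (P t j - w j) ^ Suc n) / (real (Suc n) * W t (asg t j) ^ n) \<le> \<alpha> t j"
proof -
  let ?W = "W t (asg t j)" and ?S = "speed_for (p (asg t j))"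
  let ?D = "P t j * (P t j ^ n - (P t j - w j) ^ n)"
  have "real n * (P t j ^ Suc n - (P t j - w j) ^ Suc n) \<le> real (Suc n) * ?D"
    using P_bounds by (intro power_diff_lower) auto
  then have "(P t j ^ Suc n - (P t j - w j) ^ Suc n) / (real (Suc n) * ?W ^ n) \<le> ?D / (real n * ?W ^ n)"
    using W_pos n_pos by (simp add: divide_simps del: power_Suc of_nat_Suc)
      (simp add: mult.commute mult.left_commute del: power_Suc of_nat_Suc)
  also have "\<dots> = 1 * ?D / (real n * ?W ^ n)" by simp
  also have "\<dots> \<le> \<alpha> t j"
    unfolding \<alpha>_eq using P_pos W_pos speed_pos power_diff_nonneg P_bounds
    by (intro divide_right_mono mult_right_mono) (auto intro: f.speed_for_mono)
  finally show ?thesis .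
qed

lemma \<alpha>_nonneg: "0 \<le> \<alpha> t j"
  using \<nu>_nonneg price_nonneg[of "asg t j" "P t j"] asg_less[OF j] P_pos \<eta>_pos j
  unfolding \<alpha>_def by simp

end

lemma sum_\<nu>:
  assumes i: "i < m"
  shows "(\<Sum>j | j \<in> Al t \<and> asg t j = i. \<nu> t j) = \<eta> * speed_for (p i) (W t i)"
proof (cases "W t i = 0")
  case True
  have "{j. j \<in> Al t \<and> asg t j = i} = {}" using W_pos True by force
  moreover have "speed_for (p i) 0 = 0"
    by (rule power_function.speed_for_zero[OF power[OF i]])
  ultimately show ?thesis using True by (simp only: sum.empty)
next
  case False
  have "(\<Sum>j | j \<in> Al t \<and> asg t j = i. P t j ^ n - (P t j - w j) ^ n) = W t i ^ n - 0 ^ n"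
    unfolding P_def W_def by (rule sum_queue_telescope) (auto simp: inj_key)
  then have "(\<Sum>j | j \<in> Al t \<and> asg t j = i. (P t j ^ n - (P t j - w j) ^ n) / W t i ^ n) = 1"
    using False n_pos by (simp flip: sum_divide_distrib)
  moreover have "(\<Sum>j | j \<in> Al t \<and> asg t j = i. \<nu> t j) = (\<Sum>j | j \<in> Al t \<and> asg t j = i.
      \<eta> * speed_for (p i) (W t i) * ((P t j ^ n - (P t j - w j) ^ n) / W t i ^ n))"
    by (intro sum.cong) (auto simp: \<nu>_def)
  ultimately show ?thesis by (simp only: mult_1_right flip: sum_distrib_left)
qed

lemma sum_\<alpha>_ge: "total t / real (Suc n) \<le> (\<Sum>j\<in>jobs I. \<alpha> t j)"
proof -
  have "W t i / real (Suc n) \<le> (\<Sum>j | j \<in> Al t \<and> asg t j = i. \<alpha> t j)" if i: "i < m" for i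
  proof (cases "W t i = 0")
    case True
    then show ?thesis using \<alpha>_nonneg by (auto intro!: sum_nonneg)
  next
    case False
    let ?D = "\<lambda>j. P t j ^ Suc n - (P t j - w j) ^ Suc n"
    have "(\<Sum>j | j \<in> Al t \<and> asg t j = i. ?D j) = W t i ^ Suc n - 0 ^ Suc n"
      unfolding P_def W_def by (rule sum_queue_telescope) (auto simp: inj_key)
    then have "W t i / real (Suc n) =
        (\<Sum>j | j \<in> Al t \<and> asg t j = i. ?D j) / (real (Suc n) * W t i ^ n)"
      using False by (simp del: of_nat_Suc)
    also have "\<dots> = (\<Sum>j | j \<in> Al t \<and> asg t j = i. ?D j / (real (Suc n) * W t (asg t j) ^ n))"
      unfolding sum_divide_distrib by (intro sum.cong) auto
    also have "\<dots> \<le> (\<Sum>j | j \<in> Al t \<and> asg t j = i. \<alpha> t j)"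
      using \<alpha>_ge by (intro sum_mono) blast
    finally show ?thesis .
  qed
  then have "(\<Sum>i<m. W t i / real (Suc n)) \<le> (\<Sum>i<m. \<Sum>j | j \<in> Al t \<and> asg t j = i. \<alpha> t j)"
    by (intro sum_mono) auto
  also have "\<dots> = (\<Sum>j\<in>Al t. \<alpha> t j)" by (rule sum_over_queues[symmetric])
  also have "\<dots> = (\<Sum>j\<in>jobs I. \<alpha> t j)"
    using Al_jobs by (intro sum.mono_neutral_left) (auto simp: \<alpha>_def)
  finally show ?thesis by (simp add: sum_W flip: sum_divide_distrib)
qed

end

text \<open>The price is frozen at \<open>t\<close> while the factor at \<open>s\<close> is the
  algorithm's own processing rate. Integrated over all later \<open>s\<close>, the right-hand side
  is therefore bounded by the price times the length.\<close>

lemma \<alpha>_bound: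
  assumes "0 \<le> t" "t \<le> s" "j \<in> Al t" "j \<in> Al s" "i < m"
  shows "l i j * \<alpha> s j \<le> price i (W t i + w j) / (real n * \<eta>) * processing_rate I (\<sigma> s) j"
proof -
  have s: "0 \<le> s" using assms by simp
  define S where "S = speed_for (p i) (W t i + w j)"
  define R where "R = speed_for (p (asg s j)) (P s j)"
  have Wt: "0 < W t i + w j" using W_nonneg[of t i] w_pos Al_jobs assms by fastforce
  have S: "0 < S" unfolding S_def by (rule power_function.speed_for_pos[OF power Wt]) fact
  have R: "0 < R" unfolding R_def by (rule speed_pos) fact+
  have Ps: "0 < P s j" by (rule P_pos) fact+
  have "offer p l i j (W t i + w j) \<le> util t j"
    using good[OF assms(1)] assms unfolding good_def equilibrium_def util_def W_def by blast
  also have "\<dots> \<le> util s j" using assms m by (intro util_mono) auto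
  finally have "l i j * (S / (W t i + w j)) \<le> l (asg s j) j * (R / P s j)"
    unfolding offer_def util_def utility_def S_def R_def P_def .
  \<comment> \<open>Cross-multiplying instead of inverting utilities keeps rates that are zero
    within the same argument.\<close>
  then have "l i j * (P s j / R) \<le> (W t i + w j) / S * l (asg s j) j"
    using S R Ps Wt by (simp add: field_simps)
  then have "l i j * (P s j / R) * (\<nu> s j / (real n * \<eta>)) \<le>
      (W t i + w j) / S * l (asg s j) j * (\<nu> s j / (real n * \<eta>))"
    using \<nu>_nonneg[OF s assms(4)] \<eta>_pos by (intro mult_right_mono) auto
  then show ?thesis
    using assms(4) by (simp add: processing_rate_eq[OF s] \<alpha>_def price_def S_def R_def mult_ac)
qed

end

end

section \<open>Feasibility\<close>

lemma processing_rate_measurable: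
  assumes "feasible c M I \<sigma>" "j \<in> jobs I"
  shows "(\<lambda>t. processing_rate I (\<sigma> t) j) \<in> borel_measurable time"
  unfolding processing_rate_def
proof (rule measurable_compose_countable)
  show "(\<lambda>t. assigned (\<sigma> t) j) \<in> measurable time (count_space UNIV)"
    using assms unfolding feasible_def measurable_time_iff by blast
  have [measurable]: "(\<lambda>t. share (\<sigma> t) j) \<in> borel_measurable time"
    using assms unfolding feasible_def measurable_time_iff by blast
  show "(\<lambda>t. case k of None \<Rightarrow> 0 | Some i \<Rightarrow> rate I i j * share (\<sigma> t) j) \<in> borel_measurable time" for k
    by (cases k) auto
qed

lemma feasible_total_processed_le:
  assumes "feasible c M I \<sigma>" "j \<in> jobs I" "0 \<le> release I j"
  shows "(\<integral>\<^sup>+ t. ennreal (processing_rate I (\<sigma> t) j) \<partial>time) \<le> ennreal (len I j)"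
proof (rule total_processed_le)
  show "processing_rate I (\<sigma> t) j \<le> 0" if "0 \<le> t" "\<not> alive I \<sigma> j t" for t
    using assms(1,2) that unfolding feasible_def processing_rate_def
    by (auto split: option.split)
qed (use assms processing_rate_measurable in auto)

lemma total_processed_ge:
  assumes "completion I \<sigma> j < top"
  shows "ennreal (len I j) \<le> (\<integral>\<^sup>+ t. ennreal (processing_rate I (\<sigma> t) j) \<partial>time)"
proof -
  obtain t where "ennreal (len I j) \<le> processed I \<sigma> j t"
    using assms by (rule completion_lessE)
  also have "\<dots> \<le> (\<integral>\<^sup>+ t. ennreal (processing_rate I (\<sigma> t) j) \<partial>time)"
    unfolding processed_time by (intro nn_integral_mono) (auto split: split_indicator)
  finally show ?thesis .
qed

lemma alive_measurable:
  assumes "j \<in> jobs I" "0 \<le> release I j"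
  shows "(indicator {t. alive I \<sigma> j t} :: real \<Rightarrow> ennreal) \<in> borel_measurable time"
  unfolding alive_iff[OF assms] by (rule indicator_measurable_time) auto

lemma weighted_flow_time_eq:
  assumes "j \<in> jobs I" "0 \<le> release I j"
  shows "c * flow_time I \<sigma> j = (\<integral>\<^sup>+ t. c * indicator {t. alive I \<sigma> j t} t \<partial>time)"
  unfolding flow_time_eq[OF assms] by (rule nn_integral_cmult[symmetric, OF alive_measurable[OF assms]])

context migration
begin

lemma run_feasible: "feasible \<eta> M I \<sigma>"
  unfolding feasible_def measurable_time_iff
proof (intro conjI allI ballI impI)
  fix i
  have "(\<lambda>t. speed (migrate \<eta> n M 0 (obs t)) i) \<in> borel_measurable time"
    by (rule measurable_determined) auto
  then show "(\<lambda>t. speed (\<sigma> t) i) \<in> borel_measurable time"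
    by (rule measurable_cong[THEN iffD1, rotated]) (simp add: \<sigma>_eq space_restrict_space)
next
  fix j
  have "(\<lambda>t. assigned (migrate \<eta> n M 0 (obs t)) j) \<in> measurable time (count_space UNIV)"
    by (rule measurable_determined) auto
  then show "(\<lambda>t. assigned (\<sigma> t) j) \<in> measurable time (count_space UNIV)"
    by (rule measurable_cong[THEN iffD1, rotated]) (simp add: \<sigma>_eq space_restrict_space)
  have "(\<lambda>t. share (migrate \<eta> n M 0 (obs t)) j) \<in> borel_measurable time"
    by (rule measurable_determined) auto
  then show "(\<lambda>t. share (\<sigma> t) j) \<in> borel_measurable time"
    by (rule measurable_cong[THEN iffD1, rotated]) (simp add: \<sigma>_eq space_restrict_space)
next
  fix t :: real and j i assume t: "0 \<le> t" and j: "j \<in> jobs I" and a: "assigned (\<sigma> t) j = Some i"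
  then show im: "i < m"
    by (auto simp: \<sigma>_eq migrate_def Let_def split: prod.splits if_splits)
  then have m: "0 < m" by simp
  then have "j \<in> Al t" using a by (simp add: assigned_eq[OF m t] split: if_splits)
  then show "alive I \<sigma> j t" "0 \<le> share (\<sigma> t) j"
    using share_eq[OF m t] \<nu>_nonneg[OF m t] unfolding Al_def by auto
next
  fix t :: real and i assume t: "0 \<le> t" and i: "i < m"
  then have m: "0 < m" by simp
  show "0 \<le> speed (\<sigma> t) i"
    unfolding speed_eq[OF m t] using power[OF i] W_nonneg by (rule power_function.speed_for_nonneg)
  have "{j \<in> jobs I. assigned (\<sigma> t) j = Some i} = {j. j \<in> Al t \<and> asg t j = i}"
    using Al_jobs by (auto simp: assigned_eq[OF m t] split: if_splits)
  then have "(\<Sum>j | j \<in> jobs I \<and> assigned (\<sigma> t) j = Some i. share (\<sigma> t) j) =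
      (\<Sum>j | j \<in> Al t \<and> asg t j = i. \<nu> t j)"
    by (simp add: share_eq[OF m t])
  then show "(\<Sum>j | j \<in> jobs I \<and> assigned (\<sigma> t) j = Some i. share (\<sigma> t) j) \<le> \<eta> * speed (\<sigma> t) i"
    by (simp add: sum_\<nu>[OF m t i] speed_eq[OF m t])
qed

lemma completion_finite:
  assumes finite_cost: "cost M I \<tau> < top" and j: "j \<in> jobs I"
  shows "completion I \<tau> j < top"
proof (rule ccontr)
  assume "\<not> ?thesis"
  then have "ennreal (w j) * flow_time I \<tau> j = top"
    using w_pos[OF j] by (simp add: flow_time_def less_top[symmetric] ennreal_mult_top)
  moreover have "ennreal (w j) * flow_time I \<tau> j \<le> (\<Sum>j\<in>jobs I. ennreal (w j) * flow_time I \<tau> j)"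
    using j by (intro member_le_sum) auto
  ultimately show False using finite_cost unfolding cost_def by (auto simp: top_unique)
qed

section \<open>Comparison with a feasible schedule\<close>

text \<open>The horizon \<open>T\<close> keeps all integrals finite, whether or not all jobs complete.\<close>

definition \<alpha>_int :: "real \<Rightarrow> nat \<Rightarrow> ennreal" where
  "\<alpha>_int T j = (\<integral>\<^sup>+ s. ennreal (\<alpha> s j) * indicator {..T} s \<partial>time)"

context
  fixes \<tau> :: schedule
  assumes m: "0 < m" and \<tau>: "feasible 1 M I \<tau>" and finite_cost: "cost M I \<tau> < top"
begin

text \<open>A dual constraint for machine \<open>i\<close> and time \<open>t\<close>. Charges before
  \<open>t\<close> are at most the weight; those from \<open>t\<close> on are paid at the price of
  time \<open>t\<close> by processing, which never exceeds the length. Beyond the horizon the second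
  kind is absent, hence the indicator.\<close>

lemma \<alpha>_int_le:
  assumes j: "j \<in> jobs I" and i: "i < m" and t: "r j \<le> t"
  shows "ennreal (l i j) * \<alpha>_int T j \<le> ennreal (l i j * w j * (t - r j)) +
    ennreal (price i (W t i + w j) / (real n * \<eta>) * len I j) * indicator {..T} t"
proof -
  define c where "c = price i (W t i + w j) / (real n * \<eta>)"
  let ?\<rho> = "\<lambda>s. processing_rate I (\<sigma> s) j"
  have t0: "0 \<le> t" using r_nonneg[OF j] t by simp
  have l0: "0 \<le> l i j" using l_nonneg[OF j i] .
  have w0: "0 < w j" using w_pos[OF j] .
  have c0: "0 \<le> c"
    unfolding c_def using price_nonneg[OF i, of "W t i + w j"] W_nonneg[of t i] w0 \<eta>_pos by simp
  have [measurable]: "?\<rho> \<in> borel_measurable time"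
    using run_feasible j by (rule processing_rate_measurable)
  have ind: "(indicator {..T} :: real \<Rightarrow> ennreal) \<in> borel_measurable time"
    by (rule indicator_measurable_time) auto
  have "ennreal (l i j) * \<alpha>_int T j = (\<integral>\<^sup>+ s. ennreal (l i j) * (ennreal (\<alpha> s j) * indicator {..T} s) \<partial>time)"
    unfolding \<alpha>_int_def
    by (intro nn_integral_cmult[symmetric] borel_measurable_times_ennreal ind) simp
  also have "\<dots> \<le> (\<integral>\<^sup>+ s. (ennreal (l i j * w j) * indicator {r j..<t} s +
      (ennreal c * indicator {..T} t) * ennreal (?\<rho> s)) \<partial>time)"
  proof (rule nn_integral_mono)
    fix s assume "s \<in> space time"
    then have s: "0 \<le> s" by (simp add: space_restrict_space)
    show "ennreal (l i j) * (ennreal (\<alpha> s j) * indicator {..T} s) \<le>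
      ennreal (l i j * w j) * indicator {r j..<t} s + (ennreal c * indicator {..T} t) * ennreal (?\<rho> s)"
    proof (cases "j \<in> Al s \<and> s \<le> T")
      case True
      then have rs: "r j \<le> s" by (simp add: Al_def alive_def)
      show ?thesis
      proof (cases "s < t")
        case True
        have "l i j * \<alpha> s j \<le> l i j * w j"
          using \<alpha>_le_w[OF m s] \<open>j \<in> Al s \<and> s \<le> T\<close> l0 by (intro mult_left_mono) auto
        then have "ennreal (l i j) * ennreal (\<alpha> s j) \<le> ennreal (l i j * w j)"
          using l0 by (simp add: ennreal_leI flip: ennreal_mult')
        then show ?thesis using True rs \<open>j \<in> Al s \<and> s \<le> T\<close> by (simp add: add_increasing2)
      next
        case False
        \<comment> \<open>A job charged at \<open>s\<close> has been alive since its release, so the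
          equilibrium at \<open>t\<close> applies to it.\<close>
        then have "j \<in> Al t" using Al_earlier[of j s t] t True by auto
        then have "l i j * \<alpha> s j \<le> c * ?\<rho> s"
          unfolding c_def using \<alpha>_bound[OF m t0, of s j i] False True i by auto
        then have "ennreal (l i j) * ennreal (\<alpha> s j) \<le> ennreal c * ennreal (?\<rho> s)"
          using l0 c0 by (simp add: ennreal_leI flip: ennreal_mult')
        then show ?thesis using True False by simp
      qed
    qed (auto simp: \<alpha>_def)
  qed
  also have "\<dots> = (\<integral>\<^sup>+ s. ennreal (l i j * w j) * indicator {r j..<t} s \<partial>time) +
      (\<integral>\<^sup>+ s. (ennreal c * indicator {..T} t) * ennreal (?\<rho> s) \<partial>time)"
    by (intro nn_integral_add borel_measurable_times_ennreal indicator_measurable_time) auto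
  also have "\<dots> = ennreal (l i j * w j) * ennreal (t - r j) +
      (ennreal c * indicator {..T} t) * (\<integral>\<^sup>+ s. ennreal (?\<rho> s) \<partial>time)"
    using r_nonneg[OF j] by (simp add: nn_integral_time_Icc nn_integral_cmult)
  also have "\<dots> \<le> ennreal (l i j * w j) * ennreal (t - r j) +
      (ennreal c * indicator {..T} t) * ennreal (len I j)"
    using feasible_total_processed_le[OF run_feasible j r_nonneg[OF j]]
    by (intro add_left_mono mult_left_mono) auto
  also have "\<dots> = ennreal (l i j * w j * (t - r j)) + ennreal (c * len I j) * indicator {..T} t"
    using t l0 w0 c0 by (simp add: ennreal_mult' mult_ac)
  finally show ?thesis unfolding c_def .
qed

text \<open>What \<open>\<tau>\<close> would pay, at the algorithm's current prices, for the speed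
  it gives to \<open>j\<close>.\<close>

definition \<beta> :: "real \<Rightarrow> nat \<Rightarrow> real" where
  "\<beta> t j = (case assigned (\<tau> t) j of None \<Rightarrow> 0
     | Some i \<Rightarrow> price i (W t i + w j) / (real n * \<eta>) * share (\<tau> t) j)"

lemma assigned_\<tau>:
  assumes "0 \<le> t" "j \<in> jobs I" "assigned (\<tau> t) j = Some i"
  shows "i < m" "alive I \<tau> j t" "0 \<le> share (\<tau> t) j"
  using \<tau> assms unfolding feasible_def by auto

lemma \<beta>_nonneg:
  assumes "0 \<le> t" "j \<in> jobs I" shows "0 \<le> \<beta> t j"
proof (cases "assigned (\<tau> t) j")
  case (Some i)
  then show ?thesis
    using assigned_\<tau>[OF assms Some] price_nonneg[of i "W t i + w j"] W_nonneg[of t i]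
      w_pos[OF assms(2)] \<eta>_pos by (simp add: \<beta>_def)
qed (simp add: \<beta>_def)

lemma \<beta>_measurable:
  assumes "j \<in> jobs I" shows "(\<lambda>t. \<beta> t j) \<in> borel_measurable time"
  unfolding \<beta>_def
proof (rule measurable_compose_countable)
  show "(\<lambda>t. assigned (\<tau> t) j) \<in> measurable time (count_space UNIV)"
    using \<tau> assms unfolding feasible_def measurable_time_iff by blast
  have [measurable]: "(\<lambda>t. share (\<tau> t) j) \<in> borel_measurable time"
    using \<tau> assms unfolding feasible_def measurable_time_iff by blast
  show "(\<lambda>t. case k of None \<Rightarrow> 0 | Some i \<Rightarrow> price i (W t i + w j) / (real n * \<eta>) * share (\<tau> t) j)
      \<in> borel_measurable time" for k
    by (cases k) auto
qed

text \<open>The dual constraint at each \<open>t\<close>, weighted by the rate at which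
  \<open>\<tau>\<close> processes \<open>j\<close>. That rate integrates to the length: not less,
  since finite cost forces completion, and not more, by feasibility. While \<open>j\<close> is alive
  in \<open>\<tau>\<close> its age is at most its flow time. Finally the positive length is
  cancelled.\<close>

lemma \<alpha>_int_le_flow:
  assumes j: "j \<in> jobs I"
  shows "\<alpha>_int T j \<le> ennreal (w j) * flow_time I \<tau> j +
    (\<integral>\<^sup>+ t. ennreal (\<beta> t j) * indicator {..T} t \<partial>time)"
proof -
  let ?\<rho> = "\<lambda>t. processing_rate I (\<tau> t) j" and ?F = "flow_time I \<tau> j"
  let ?L = "ennreal (len I j)"
  have [measurable]: "?\<rho> \<in> borel_measurable time"
    using \<tau> j by (rule processing_rate_measurable)
  have \<beta>_ind: "(\<lambda>t. ennreal (\<beta> t j) * indicator {..T} t) \<in> borel_measurable time"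
    using \<beta>_measurable[OF j]
    by (intro borel_measurable_times_ennreal indicator_measurable_time) auto
  have "\<alpha>_int T j * ?L \<le> \<alpha>_int T j * (\<integral>\<^sup>+ t. ennreal (?\<rho> t) \<partial>time)"
    by (intro mult_left_mono total_processed_ge completion_finite finite_cost j) simp
  also have "\<dots> = (\<integral>\<^sup>+ t. \<alpha>_int T j * ennreal (?\<rho> t) \<partial>time)"
    by (intro nn_integral_cmult[symmetric]) simp
  also have "\<dots> \<le> (\<integral>\<^sup>+ t. (ennreal (w j) * ?F * ennreal (?\<rho> t) +
      ?L * (ennreal (\<beta> t j) * indicator {..T} t)) \<partial>time)"
  proof (rule nn_integral_mono)
    fix t assume "t \<in> space time"
    then have t: "0 \<le> t" by (simp add: space_restrict_space)
    show "\<alpha>_int T j * ennreal (?\<rho> t) \<le> ennreal (w j) * ?F * ennreal (?\<rho> t) +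
        ?L * (ennreal (\<beta> t j) * indicator {..T} t)"
    proof (cases "assigned (\<tau> t) j")
      case None
      then show ?thesis by (simp add: processing_rate_def)
    next
      case (Some i)
      note a = assigned_\<tau>[OF t j Some]
      let ?s = "share (\<tau> t) j" and ?c = "price i (W t i + w j) / (real n * \<eta>)"
      have \<rho>: "?\<rho> t = l i j * ?s" using Some by (simp add: processing_rate_def)
      have l0: "0 \<le> l i j" using l_nonneg[OF j a(1)] .
      have c0: "0 \<le> ?c"
        using price_nonneg[OF a(1), of "W t i + w j"] W_nonneg[of t i] w_pos[OF j] \<eta>_pos by simp
      have rt: "r j \<le> t" using a(2) by (simp add: alive_def)
      have flow_part: "ennreal (l i j * w j * (t - r j)) * ennreal ?s =
          ennreal (w j) * ennreal (t - r j) * ennreal (?\<rho> t)"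
        unfolding \<rho> using l0 rt w_pos[OF j] a(3) by (simp add: mult_ac flip: ennreal_mult)
      have \<beta>: "\<beta> t j = ?c * ?s" using Some by (simp add: \<beta>_def)
      have price_part: "ennreal (?c * len I j) * indicator {..T} t * ennreal ?s =
          ?L * (ennreal (\<beta> t j) * indicator {..T} t)"
        unfolding \<beta> ennreal_mult'[OF c0] by (simp only: mult_ac)
      have "\<alpha>_int T j * ennreal (?\<rho> t) = ennreal (l i j) * \<alpha>_int T j * ennreal ?s"
        unfolding \<rho> ennreal_mult'[OF l0] by (simp only: mult_ac)
      also have "\<dots> \<le> (ennreal (l i j * w j * (t - r j)) +
          ennreal (?c * len I j) * indicator {..T} t) * ennreal ?s"
        by (intro mult_right_mono \<alpha>_int_le[OF j a(1) rt]) simp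
      also have "\<dots> = ennreal (w j) * ennreal (t - r j) * ennreal (?\<rho> t) +
          ?L * (ennreal (\<beta> t j) * indicator {..T} t)"
        by (simp only: distrib_right flow_part price_part)
      also have "\<dots> \<le> ennreal (w j) * ?F * ennreal (?\<rho> t) +
          ?L * (ennreal (\<beta> t j) * indicator {..T} t)"
        using flow_time_ge[OF a(2) r_nonneg[OF j]]
        by (intro add_right_mono mult_right_mono mult_left_mono) auto
      finally show ?thesis .
    qed
  qed
  also have "\<dots> = ennreal (w j) * ?F * (\<integral>\<^sup>+ t. ennreal (?\<rho> t) \<partial>time) +
      ?L * (\<integral>\<^sup>+ t. ennreal (\<beta> t j) * indicator {..T} t \<partial>time)"
    using \<beta>_ind by (simp add: nn_integral_add nn_integral_cmult)
  also have "\<dots> \<le> ennreal (w j) * ?F * ?L + ?L * (\<integral>\<^sup>+ t. ennreal (\<beta> t j) * indicator {..T} t \<partial>time)"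
    by (intro add_right_mono mult_left_mono feasible_total_processed_le[OF \<tau> j r_nonneg[OF j]]) simp
  finally have "?L * \<alpha>_int T j \<le> ?L * (ennreal (w j) * ?F +
      (\<integral>\<^sup>+ t. ennreal (\<beta> t j) * indicator {..T} t \<partial>time))"
    by (simp add: distrib_left mult_ac)
  then show ?thesis using len_pos[OF j] by (simp add: ennreal_mult_le_mult_iff)
qed

definition alive_weight :: "real \<Rightarrow> real" where
  "alive_weight t = (\<Sum>j\<in>jobs I. w j * indicator {t. alive I \<tau> j t} t)"

text \<open>The price at \<open>W + w\<close> splits into the prices at \<open>W\<close> and at
  \<open>w\<close>. The first, taken against the whole speed of a machine, costs \<open>W\<close>
  plus its power; the second, taken job by job, costs the job weights plus powers of single shares,
  which superadditivity collects into one more power of the machine.\<close>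

lemma sum_\<beta>_le:
  assumes t: "0 \<le> t"
  shows "real n * \<eta> * (\<Sum>j\<in>jobs I. \<beta> t j) \<le>
    total t + 2 * (\<Sum>i<m. p i (speed (\<tau> t) i)) + alive_weight t"
proof -
  let ?s = "share (\<tau> t)" and ?S = "speed (\<tau> t)"
  let ?J = "\<lambda>i. {j \<in> jobs I. assigned (\<tau> t) j = Some i}"
  let ?K = "{j \<in> jobs I. assigned (\<tau> t) j \<noteq> None}"
  have machine: "(\<Sum>j\<in>?J i. price i (W t i + w j) * ?s j) \<le> W t i + 2 * p i (?S i) + (\<Sum>j\<in>?J i. w j)"
    if i: "i < m" for i
  proof -
    interpret f: power_function "p i" by (rule power[OF i])
    have s0: "0 \<le> ?s j" if "j \<in> ?J i" for j using assigned_\<tau>[OF t, of j i] that by auto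
    have sum_s: "(\<Sum>j\<in>?J i. ?s j) \<le> ?S i" and S0: "0 \<le> ?S i"
      using \<tau> t i unfolding feasible_def by auto
    have sum0: "0 \<le> (\<Sum>j\<in>?J i. ?s j)" using s0 by (rule sum_nonneg)
    have "price i (W t i + w j) * ?s j \<le> price i (W t i) * ?s j + (w j + p i (?s j))"
      if j: "j \<in> ?J i" for j
    proof -
      have "0 < w j" using j w_pos by auto
      then have "price i (W t i + w j) * ?s j \<le> (price i (W t i) + price i (w j)) * ?s j"
        unfolding price_def using W_nonneg s0[OF j]
        by (intro mult_right_mono f.ratio_subadditive) auto
      also have "price i (w j) * ?s j \<le> w j + p i (?s j)"
        unfolding price_def using \<open>0 < w j\<close> s0[OF j] by (intro f.ratio_times_speed_le) auto
      then have "(price i (W t i) + price i (w j)) * ?s j \<le>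
          price i (W t i) * ?s j + (w j + p i (?s j))" by (simp add: distrib_right)
      finally show ?thesis .
    qed
    then have "(\<Sum>j\<in>?J i. price i (W t i + w j) * ?s j) \<le>
        (\<Sum>j\<in>?J i. price i (W t i) * ?s j + (w j + p i (?s j)))"
      by (rule sum_mono)
    also have "\<dots> = price i (W t i) * (\<Sum>j\<in>?J i. ?s j) + (\<Sum>j\<in>?J i. p i (?s j)) + (\<Sum>j\<in>?J i. w j)"
      by (simp add: sum.distrib sum_distrib_left)
    also have "\<dots> \<le> (W t i + p i (\<Sum>j\<in>?J i. ?s j)) + p i (\<Sum>j\<in>?J i. ?s j) + (\<Sum>j\<in>?J i. w j)"
      unfolding price_def using W_nonneg sum0 s0
      by (intro add_mono f.ratio_times_speed_le f.sum_le_of_sum order_refl) auto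
    also have "\<dots> \<le> W t i + 2 * p i (?S i) + (\<Sum>j\<in>?J i. w j)"
      using f.mono[OF sum0 sum_s] by simp
    finally show ?thesis .
  qed
  have group: "(\<Sum>j\<in>?K. g j) = (\<Sum>i<m. \<Sum>j\<in>?J i. g j)" for g :: "nat \<Rightarrow> real"
  proof -
    have "(\<Sum>i<m. \<Sum>j | j \<in> ?K \<and> the (assigned (\<tau> t) j) = i. g j) = (\<Sum>j\<in>?K. g j)"
      using assigned_\<tau>(1)[OF t] by (intro sum.group) auto
    moreover have "{j. j \<in> ?K \<and> the (assigned (\<tau> t) j) = i} = ?J i" for i by auto
    ultimately show ?thesis by simp
  qed
  have "real n * \<eta> * (\<Sum>j\<in>jobs I. \<beta> t j) = (\<Sum>j\<in>?K. real n * \<eta> * \<beta> t j)"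
    unfolding sum_distrib_left by (rule sum.mono_neutral_right) (auto simp: \<beta>_def)
  also have "\<dots> = (\<Sum>i<m. \<Sum>j\<in>?J i. price i (W t i + w j) * ?s j)"
    unfolding group using \<eta>_pos n_pos by (intro sum.cong) (auto simp: \<beta>_def)
  also have "\<dots> \<le> (\<Sum>i<m. W t i + 2 * p i (?S i) + (\<Sum>j\<in>?J i. w j))"
    using machine by (intro sum_mono) auto
  also have "\<dots> = total t + 2 * (\<Sum>i<m. p i (?S i)) + (\<Sum>j\<in>?K. w j)"
    unfolding group by (simp add: sum.distrib sum_distrib_left sum_W[OF m t])
  also have "(\<Sum>j\<in>?K. w j) \<le> (\<Sum>j\<in>jobs I. w j * indicator {t. alive I \<tau> j t} t)"
  proof -
    have "(\<Sum>j\<in>?K. w j) = (\<Sum>j\<in>?K. w j * indicator {t. alive I \<tau> j t} t)"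
      using assigned_\<tau>(2)[OF t] by (intro sum.cong) auto
    also have "\<dots> \<le> (\<Sum>j\<in>jobs I. w j * indicator {t. alive I \<tau> j t} t)"
      using w_pos by (intro sum_mono2) (auto simp: less_imp_le)
    finally show ?thesis .
  qed
  finally show ?thesis unfolding alive_weight_def by simp
qed

section \<open>Integration up to the horizon and absorption of the algorithm's cost\<close>

definition X :: "real \<Rightarrow> ennreal" where
  "X T = (\<integral>\<^sup>+ t. ennreal (total t) * indicator {..T} t \<partial>time)"

text \<open>\<open>X T\<close> will occur on both sides of the final inequality and can only be
  subtracted if it is finite.\<close>

lemma X_finite: "X T < top"
proof -
  have "X T \<le> (\<integral>\<^sup>+ t. ennreal (sum w (jobs I)) * indicator {0..<\<bar>T\<bar> + 1} t \<partial>time)"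
    unfolding X_def using total_le
    by (intro nn_integral_mono) (auto simp: space_restrict_space ennreal_leI split: split_indicator)
  also have "\<dots> < top"
    by (simp add: nn_integral_time_Icc ennreal_mult_less_top)
  finally show ?thesis .
qed

definition flow_opt :: ennreal where
  "flow_opt = (\<Sum>j\<in>jobs I. ennreal (w j) * flow_time I \<tau> j)"

definition energy_opt :: ennreal where
  "energy_opt = (\<Sum>i<m. \<integral>\<^sup>+ t. ennreal (p i (speed (\<tau> t) i)) \<partial>time)"

lemma cost_\<tau>: "cost M I \<tau> = flow_opt + energy_opt"
  unfolding cost_def flow_opt_def energy_opt_def nn_integral_time ..

lemma total_le_sum_\<alpha>_int: "ennreal (1 / real (Suc n)) * X T \<le> (\<Sum>j\<in>jobs I. \<alpha>_int T j)"
proof -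
  have ind: "(indicator {..T} :: real \<Rightarrow> ennreal) \<in> borel_measurable time"
    by (rule indicator_measurable_time) auto
  have "ennreal (1 / real (Suc n)) * X T =
      (\<integral>\<^sup>+ t. ennreal (1 / real (Suc n)) * (ennreal (total t) * indicator {..T} t) \<partial>time)"
    unfolding X_def by (intro nn_integral_cmult[symmetric] borel_measurable_times_ennreal ind) simp
  also have "\<dots> \<le> (\<integral>\<^sup>+ t. (\<Sum>j\<in>jobs I. ennreal (\<alpha> t j) * indicator {..T} t) \<partial>time)"
  proof (rule nn_integral_mono)
    fix t assume "t \<in> space time"
    then have t: "0 \<le> t" by (simp add: space_restrict_space)
    have \<alpha>0: "0 \<le> \<alpha> t j" for j
      using \<alpha>_nonneg[OF m t] by (cases "j \<in> Al t") (auto simp: \<alpha>_def)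
    have "ennreal (1 / real (Suc n)) * ennreal (total t) = ennreal (total t / real (Suc n))"
      by (simp del: of_nat_Suc flip: ennreal_mult')
    also have "\<dots> \<le> ennreal (\<Sum>j\<in>jobs I. \<alpha> t j)" by (intro ennreal_leI sum_\<alpha>_ge[OF m t])
    also have "\<dots> = (\<Sum>j\<in>jobs I. ennreal (\<alpha> t j))" using \<alpha>0 by (intro sum_ennreal[symmetric])
    finally show "ennreal (1 / real (Suc n)) * (ennreal (total t) * indicator {..T} t) \<le>
        (\<Sum>j\<in>jobs I. ennreal (\<alpha> t j) * indicator {..T} t)"
      by (simp split: split_indicator)
  qed
  also have "\<dots> = (\<Sum>j\<in>jobs I. \<alpha>_int T j)"
    unfolding \<alpha>_int_def by (intro nn_integral_sum borel_measurable_times_ennreal ind) simp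
  finally show ?thesis .
qed

text \<open>Only the algorithm's own weight keeps the cut-off at \<open>T\<close>; extending the
  costs of \<open>\<tau>\<close> to all times merely weakens the bound.\<close>

lemma sum_\<beta>_int_le:
  "(\<Sum>j\<in>jobs I. \<integral>\<^sup>+ t. ennreal (\<beta> t j) * indicator {..T} t \<partial>time) \<le>
    ennreal (1 / (real n * \<eta>)) * (X T + 2 * energy_opt + flow_opt)"
proof -
  let ?c = "1 / (real n * \<eta>)"
  have c: "0 < ?c" using \<eta>_pos n_pos by simp
  have ind: "(indicator {..T} :: real \<Rightarrow> ennreal) \<in> borel_measurable time"
    by (rule indicator_measurable_time) auto
  have total_ind: "(\<lambda>t. ennreal (total t) * indicator {..T} t) \<in> borel_measurable time"
    by (intro borel_measurable_times_ennreal ind) simp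
  have speed: "(\<lambda>t. ennreal (p i (speed (\<tau> t) i))) \<in> borel_measurable time" if i: "i < m" for i
  proof -
    \<comment> \<open>Power functions are controlled on nonnegative speeds only, so the composition
      passes through the half-line on which they are continuous.\<close>
    have "(\<lambda>t. speed (\<tau> t) i) \<in> measurable time (restrict_space borel {0..})"
      using \<tau> i unfolding feasible_def measurable_time_iff
      by (intro measurable_restrict_space2) (auto simp: space_restrict_space)
    moreover have "p i \<in> borel_measurable (restrict_space borel {0..})"
      by (rule borel_measurable_continuous_on_restrict[OF power_function.continuous[OF power[OF i]]])
    ultimately have "(\<lambda>t. p i (speed (\<tau> t) i)) \<in> borel_measurable time"
      by (rule measurable_compose)
    then show ?thesis by simp
  qed
  have alive: "(\<lambda>t. ennreal (w j) * indicator {t. alive I \<tau> j t} t) \<in> borel_measurable time"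
    if "j \<in> jobs I" for j
    using that r_nonneg by (intro borel_measurable_times_ennreal alive_measurable) auto
  have energy: "(\<lambda>t. \<Sum>i<m. ennreal (p i (speed (\<tau> t) i))) \<in> borel_measurable time"
    using speed by (intro borel_measurable_sum) auto
  then have energy_ind: "(\<lambda>t. 2 * (\<Sum>i<m. ennreal (p i (speed (\<tau> t) i)))) \<in> borel_measurable time"
    by (intro borel_measurable_times_ennreal) auto
  have weight_ind: "(\<lambda>t. \<Sum>j\<in>jobs I. ennreal (w j) * indicator {t. alive I \<tau> j t} t)
      \<in> borel_measurable time"
    using alive by (intro borel_measurable_sum) auto
  have "(\<Sum>j\<in>jobs I. \<integral>\<^sup>+ t. ennreal (\<beta> t j) * indicator {..T} t \<partial>time) =
      (\<integral>\<^sup>+ t. (\<Sum>j\<in>jobs I. ennreal (\<beta> t j) * indicator {..T} t) \<partial>time)"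
    using \<beta>_measurable
    by (intro nn_integral_sum[symmetric] borel_measurable_times_ennreal ind) auto
  also have "\<dots> \<le> (\<integral>\<^sup>+ t. ennreal ?c * (ennreal (total t) * indicator {..T} t +
      2 * (\<Sum>i<m. ennreal (p i (speed (\<tau> t) i))) +
      (\<Sum>j\<in>jobs I. ennreal (w j) * indicator {t. alive I \<tau> j t} t)) \<partial>time)"
  proof (rule nn_integral_mono)
    fix t assume "t \<in> space time"
    then have t: "0 \<le> t" by (simp add: space_restrict_space)
    have e0: "0 \<le> p i (speed (\<tau> t) i)" if "i < m" for i
      using power_function.nonneg[OF power[OF that]] \<tau> t that unfolding feasible_def by auto
    have "(\<Sum>j\<in>jobs I. ennreal (w j) * indicator {t. alive I \<tau> j t} t) =
        (\<Sum>j\<in>jobs I. ennreal (w j * indicator {t. alive I \<tau> j t} t))"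
      by (intro sum.cong refl) (simp split: split_indicator)
    also have "\<dots> = ennreal (alive_weight t)"
      unfolding alive_weight_def using w_pos by (intro sum_ennreal) (simp add: less_imp_le)
    finally have a: "(\<Sum>j\<in>jobs I. ennreal (w j) * indicator {t. alive I \<tau> j t} t) =
        ennreal (alive_weight t)" .
    have aw: "0 \<le> alive_weight t"
      unfolding alive_weight_def using w_pos by (intro sum_nonneg) (simp add: less_imp_le)
    have "(\<Sum>j\<in>jobs I. \<beta> t j) \<le> ?c * (total t + 2 * (\<Sum>i<m. p i (speed (\<tau> t) i)) + alive_weight t)"
      using sum_\<beta>_le[OF t] \<eta>_pos n_pos by (simp add: field_simps)
    then have "ennreal (\<Sum>j\<in>jobs I. \<beta> t j) \<le>
        ennreal (?c * (total t + 2 * (\<Sum>i<m. p i (speed (\<tau> t) i)) + alive_weight t))"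
      by (rule ennreal_leI)
    also have "\<dots> = ennreal ?c * (ennreal (total t) +
        2 * ennreal (\<Sum>i<m. p i (speed (\<tau> t) i)) + ennreal (alive_weight t))"
    proof -
      have "0 \<le> (\<Sum>i<m. p i (speed (\<tau> t) i))" using e0 by (intro sum_nonneg) simp
      then have "ennreal (total t + 2 * (\<Sum>i<m. p i (speed (\<tau> t) i)) + alive_weight t) =
          ennreal (total t) + 2 * ennreal (\<Sum>i<m. p i (speed (\<tau> t) i)) + ennreal (alive_weight t)"
        using aw total_nonneg[of t] by (simp add: ennreal_mult' del: sum_ennreal)
      then show ?thesis by (simp only: ennreal_mult'[OF less_imp_le[OF c]])
    qed
    also have "ennreal (\<Sum>i<m. p i (speed (\<tau> t) i)) = (\<Sum>i<m. ennreal (p i (speed (\<tau> t) i)))"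
      using e0 by (intro sum_ennreal[symmetric]) auto
    finally have "(\<Sum>j\<in>jobs I. ennreal (\<beta> t j)) \<le> ennreal ?c * (ennreal (total t) +
        2 * (\<Sum>i<m. ennreal (p i (speed (\<tau> t) i))) + ennreal (alive_weight t))"
      using \<beta>_nonneg[OF t] by (subst sum_ennreal) auto
    then show "(\<Sum>j\<in>jobs I. ennreal (\<beta> t j) * indicator {..T} t) \<le>
        ennreal ?c * (ennreal (total t) * indicator {..T} t +
          2 * (\<Sum>i<m. ennreal (p i (speed (\<tau> t) i))) +
          (\<Sum>j\<in>jobs I. ennreal (w j) * indicator {t. alive I \<tau> j t} t))"
      unfolding a by (auto split: split_indicator)
  qed
  also have "\<dots> = ennreal ?c * (\<integral>\<^sup>+ t. (ennreal (total t) * indicator {..T} t +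
      2 * (\<Sum>i<m. ennreal (p i (speed (\<tau> t) i))) +
      (\<Sum>j\<in>jobs I. ennreal (w j) * indicator {t. alive I \<tau> j t} t)) \<partial>time)"
    by (intro nn_integral_cmult borel_measurable_add total_ind energy_ind weight_ind)
  also have "\<dots> = ennreal ?c * (X T + 2 * (\<integral>\<^sup>+ t. (\<Sum>i<m. ennreal (p i (speed (\<tau> t) i))) \<partial>time) +
      (\<integral>\<^sup>+ t. (\<Sum>j\<in>jobs I. ennreal (w j) * indicator {t. alive I \<tau> j t} t) \<partial>time))"
    unfolding X_def using total_ind energy_ind weight_ind energy
    by (simp add: nn_integral_add nn_integral_cmult)
  also have "(\<integral>\<^sup>+ t. (\<Sum>i<m. ennreal (p i (speed (\<tau> t) i))) \<partial>time) = energy_opt"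
    unfolding energy_opt_def using speed by (intro nn_integral_sum) auto
  also have "(\<integral>\<^sup>+ t. (\<Sum>j\<in>jobs I. ennreal (w j) * indicator {t. alive I \<tau> j t} t) \<partial>time) = flow_opt"
  proof -
    have "flow_opt = (\<Sum>j\<in>jobs I. \<integral>\<^sup>+ t. ennreal (w j) * indicator {t. alive I \<tau> j t} t \<partial>time)"
      unfolding flow_opt_def using r_nonneg by (intro sum.cong refl weighted_flow_time_eq) auto
    also have "\<dots> = (\<integral>\<^sup>+ t. (\<Sum>j\<in>jobs I. ennreal (w j) * indicator {t. alive I \<tau> j t} t) \<partial>time)"
      using alive by (rule nn_integral_sum[symmetric])
    finally show ?thesis by simp
  qed
  finally show ?thesis .
qed

lemma X_le:
  assumes gap: "2 \<le> real n * (\<eta> - 1)"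
  shows "X T \<le> ennreal (2 * real n * real (Suc n) * \<eta>) * cost M I \<tau>"
proof -
  have "flow_opt < top" "energy_opt < top"
    using finite_cost unfolding cost_\<tau> by auto
  then obtain x fl en where x: "X T = ennreal x" "0 \<le> x"
    and fl: "flow_opt = ennreal fl" "0 \<le> fl" and en: "energy_opt = ennreal en" "0 \<le> en"
    using X_finite[of T] by (metis ennreal_cases less_irrefl top.not_eq_extremum)
  have "ennreal (1 / real (Suc n)) * X T \<le> (\<Sum>j\<in>jobs I. \<alpha>_int T j)"
    by (rule total_le_sum_\<alpha>_int)
  also have "\<dots> \<le> (\<Sum>j\<in>jobs I. ennreal (w j) * flow_time I \<tau> j +
      (\<integral>\<^sup>+ t. ennreal (\<beta> t j) * indicator {..T} t \<partial>time))"
    by (intro sum_mono \<alpha>_int_le_flow)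
  also have "\<dots> \<le> flow_opt + ennreal (1 / (real n * \<eta>)) * (X T + 2 * energy_opt + flow_opt)"
    unfolding sum.distrib flow_opt_def[symmetric] by (intro add_left_mono sum_\<beta>_int_le)
  finally have "ennreal (1 / real (Suc n)) * ennreal x \<le>
      ennreal fl + ennreal (1 / (real n * \<eta>)) * (ennreal x + 2 * ennreal en + ennreal fl)"
    unfolding x fl en .
  also have "\<dots> = ennreal (fl + 1 / (real n * \<eta>) * (x + 2 * en + fl))"
  proof -
    have "ennreal x + 2 * ennreal en + ennreal fl = ennreal (x + 2 * en + fl)"
      using x(2) fl(2) en(2) by (simp add: ennreal_mult')
    then show ?thesis
      using x(2) fl(2) en(2) \<eta>_pos by (simp flip: ennreal_mult' ennreal_plus)
  qed
  also have "ennreal (1 / real (Suc n)) * ennreal x = ennreal (1 / real (Suc n) * x)"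
    using x(2) by (simp del: of_nat_Suc flip: ennreal_mult')
  finally have ineq: "1 / real (Suc n) * x \<le> fl + 1 / (real n * \<eta>) * (x + 2 * en + fl)"
    using x(2) fl(2) en(2) \<eta>_pos by (subst (asm) ennreal_le_iff) auto
  define N where "N = real n * \<eta>"
  \<comment> \<open>After clearing denominators \<open>x\<close> has the factor \<open>N\<close> on
    the left and \<open>n + 1\<close> on the right. This gap leaves at least one \<open>x\<close> on
    the left.\<close>
  have N: "real n + 2 \<le> N" using gap by (simp add: N_def algebra_simps)
  then have N0: "0 < N" by simp
  have "x * N \<le> real (Suc n) * N * fl + real (Suc n) * (x + 2 * en + fl)"
    using ineq N0 unfolding N_def[symmetric] by (simp add: field_simps)
  moreover have "x * (real n + 2) \<le> x * N" using N x(2) by (rule mult_left_mono)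
  ultimately have "x \<le> real (Suc n) * (N * fl + 2 * en + fl)"
    by (simp add: algebra_simps)
  also have "\<dots> \<le> real (Suc n) * (2 * N * (fl + en))"
  proof (rule mult_left_mono)
    have "1 * fl \<le> N * fl" "1 * en \<le> N * en"
      using N fl(2) en(2) by (intro mult_right_mono; simp)+
    then show "N * fl + 2 * en + fl \<le> 2 * N * (fl + en)" by (simp add: algebra_simps)
  qed simp
  finally have "x \<le> 2 * real n * real (Suc n) * \<eta> * (fl + en)"
    by (simp only: N_def mult_ac)
  then have "ennreal x \<le> ennreal (2 * real n * real (Suc n) * \<eta> * (fl + en))"
    by (rule ennreal_leI)
  then show ?thesis
    unfolding cost_\<tau> x fl en using fl(2) en(2) \<eta>_pos
    by (simp add: ennreal_mult del: of_nat_Suc)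
qed

lemma cost_run: "cost M I \<sigma> = 2 * (\<integral>\<^sup>+ t. ennreal (total t) \<partial>time)"
proof -
  have "(\<Sum>j\<in>jobs I. ennreal (w j) * flow_time I \<sigma> j) =
      (\<Sum>j\<in>jobs I. \<integral>\<^sup>+ t. ennreal (w j) * indicator {t. alive I \<sigma> j t} t \<partial>time)"
    using r_nonneg by (intro sum.cong refl weighted_flow_time_eq) auto
  also have "\<dots> = (\<integral>\<^sup>+ t. (\<Sum>j\<in>jobs I. ennreal (w j) * indicator {t. alive I \<sigma> j t} t) \<partial>time)"
    using r_nonneg
    by (intro nn_integral_sum[symmetric] borel_measurable_times_ennreal alive_measurable) auto
  also have "\<dots> = (\<integral>\<^sup>+ t. ennreal (total t) \<partial>time)"
  proof (rule nn_integral_cong)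
    fix t
    have "(\<Sum>j\<in>jobs I. ennreal (w j) * indicator {t. alive I \<sigma> j t} t) = (\<Sum>j\<in>Al t. ennreal (w j))"
      using Al_jobs by (intro sum.mono_neutral_cong_right) (auto simp: Al_def)
    then show "(\<Sum>j\<in>jobs I. ennreal (w j) * indicator {t. alive I \<sigma> j t} t) = ennreal (total t)"
      unfolding total_def using Al_w_pos[of t] by (simp add: sum_ennreal less_imp_le)
  qed
  finally have flow: "(\<Sum>j\<in>jobs I. ennreal (w j) * flow_time I \<sigma> j) = (\<integral>\<^sup>+ t. ennreal (total t) \<partial>time)" .
  have "(\<Sum>i<m. \<integral>\<^sup>+ t. ennreal (p i (speed (\<sigma> t) i)) \<partial>time) =
      (\<Sum>i<m. \<integral>\<^sup>+ t. ennreal (W t i) \<partial>time)"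
    using power_function.f_speed_for[OF power] W_nonneg
    by (intro sum.cong nn_integral_cong) (auto simp: speed_eq[OF m] space_restrict_space)
  also have "\<dots> = (\<integral>\<^sup>+ t. (\<Sum>i<m. ennreal (W t i)) \<partial>time)"
    by (intro nn_integral_sum[symmetric]) simp
  also have "\<dots> = (\<integral>\<^sup>+ t. ennreal (total t) \<partial>time)"
    using W_nonneg
    by (intro nn_integral_cong) (auto simp: sum_ennreal sum_W[OF m] space_restrict_space)
  finally show ?thesis
    using flow unfolding cost_def nn_integral_time[symmetric] by (simp add: mult_2)
qed

text \<open>Monotone convergence removes the horizon, as the bound in \<open>X_le\<close> is the
  same for every \<open>T\<close>.\<close>

lemma total_int_eq_SUP: "(\<integral>\<^sup>+ t. ennreal (total t) \<partial>time) = (SUP k. X (real k))"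
proof -
  have "(\<integral>\<^sup>+ t. ennreal (total t) \<partial>time) =
      (\<integral>\<^sup>+ t. (SUP k. ennreal (total t) * indicator {..real k} t) \<partial>time)"
  proof (rule nn_integral_cong)
    fix t
    obtain k :: nat where "t \<le> real k" using real_arch_simple by blast
    then show "ennreal (total t) = (SUP k. ennreal (total t) * indicator {..real k} t)"
      by (intro antisym SUP_upper2[of k] SUP_least) (auto split: split_indicator)
  qed
  also have "\<dots> = (SUP k. X (real k))"
    unfolding X_def
  proof (rule nn_integral_monotone_convergence_SUP)
    show "incseq (\<lambda>k t. ennreal (total t) * indicator {..real k} t)"
      unfolding incseq_def le_fun_def by (auto split: split_indicator)
    show "(\<lambda>t. ennreal (total t) * indicator {..real k} t) \<in> borel_measurable time" for k
      by (intro borel_measurable_times_ennreal indicator_measurable_time) auto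
  qed
  finally show ?thesis .
qed

lemma cost_run_le:
  assumes gap: "2 \<le> real n * (\<eta> - 1)"
  shows "cost M I \<sigma> \<le> ennreal (4 * real n * real (Suc n) * \<eta>) * cost M I \<tau>"
proof -
  have c: "4 * real n * real (Suc n) * \<eta> = 2 * (2 * real n * real (Suc n) * \<eta>)" by simp
  have "cost M I \<sigma> \<le> 2 * (ennreal (2 * real n * real (Suc n) * \<eta>) * cost M I \<tau>)"
    unfolding cost_run total_int_eq_SUP by (intro mult_left_mono SUP_least X_le[OF gap]) simp
  also have "\<dots> = ennreal (4 * real n * real (Suc n) * \<eta>) * cost M I \<tau>"
    unfolding c by (subst ennreal_mult') (simp_all add: mult.assoc del: of_nat_Suc)
  finally show ?thesis .
qed

end

lemma cost_le:
  assumes gap: "2 \<le> real n * (\<eta> - 1)" and \<tau>: "feasible 1 M I \<tau>"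
  shows "cost M I \<sigma> \<le> ennreal (4 * real n * real (Suc n) * \<eta>) * cost M I \<tau>"
proof (cases "cost M I \<tau> < top")
  case False
  then have "cost M I \<tau> = top" by (simp add: less_top[symmetric])
  then show ?thesis using n_pos \<eta>_pos by (simp add: ennreal_mult_top del: of_nat_Suc)
next
  case True
  show ?thesis
  proof (cases "jobs I = {}")
    case False
    then obtain j where j: "j \<in> jobs I" by blast
    \<comment> \<open>Without machines no job is ever processed, while finite cost forces every job
      to complete.\<close>
    have "0 < m"
    proof (rule ccontr)
      assume "\<not> 0 < m"
      then have "processing_rate I (\<tau> t) j \<le> 0" if "0 \<le> t" for t
        using \<tau> j that unfolding feasible_def processing_rate_def by (auto split: option.split)
      then have "(\<integral>\<^sup>+ t. ennreal (processing_rate I (\<tau> t) j) \<partial>time) = (\<integral>\<^sup>+ t. 0 \<partial>time)"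
        by (intro nn_integral_cong) (simp add: space_restrict_space ennreal_neg)
      then show False
        using total_processed_ge[OF completion_finite[OF True j]] len_pos[OF j] by simp
    qed
    then show ?thesis using \<tau> True gap by (rule cost_run_le)
  next
    case empty: True
    show ?thesis
    proof (cases "0 < m")
      case m: True
      then show ?thesis using \<tau> True gap by (rule cost_run_le)
    next
      case False
      then show ?thesis using empty by (simp add: cost_def)
    qed
  qed
qed

end

lemma migrate_competitive:
  assumes "0 < n" "2 \<le> real n * \<epsilon>" "0 < \<epsilon>" "4 * real n * real (Suc n) * (1 + \<epsilon>) \<le> c"
  shows "speed_competitive (migrate (1 + \<epsilon>) n) (1 + \<epsilon>) c"
  unfolding speed_competitive_def
proof (intro allI impI conjI)
  fix M I assume MI: "valid_machines M" "valid_instance M I"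
  show "\<exists>\<sigma>. run_of (migrate (1 + \<epsilon>) n) M I \<sigma>"
    by (rule run_exists[OF _ MI(2)]) (simp add: migrate_def)
  fix \<sigma> assume "run_of (migrate (1 + \<epsilon>) n) M I \<sigma>"
  then interpret migration "1 + \<epsilon>" n M I \<sigma>
    using MI assms by unfold_locales auto
  show "feasible (1 + \<epsilon>) M I \<sigma>" by (rule run_feasible)
  let ?c = "4 * real n * real (Suc n) * (1 + \<epsilon>)"
  have c: "0 < ?c" using assms by simp
  \<comment> \<open>Dividing by the positive finite constant first turns the claim into a lower
    bound for the infimum over all competing schedules.\<close>
  have "cost M I \<sigma> / ennreal ?c \<le> offline_opt M I"
    unfolding offline_opt_def
  proof (rule INF_greatest)
    fix \<tau> assume "\<tau> \<in> {\<tau>. feasible 1 M I \<tau>}"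
    then have "cost M I \<sigma> \<le> ennreal ?c * cost M I \<tau>"
      using assms by (intro cost_le) auto
    then show "cost M I \<sigma> / ennreal ?c \<le> cost M I \<tau>"
      using c by (intro divide_le_posI_ennreal) (auto simp: mult.commute)
  qed
  then have "ennreal ?c * (cost M I \<sigma> / ennreal ?c) \<le> ennreal ?c * offline_opt M I"
    by (rule mult_left_mono) simp
  moreover have "ennreal ?c * (cost M I \<sigma> / ennreal ?c) = cost M I \<sigma>"
    using c by (subst ennreal_times_divide, subst mult.commute, intro mult_divide_eq_ennreal)
      (use assms in auto)
  ultimately have "cost M I \<sigma> \<le> ennreal ?c * offline_opt M I" by simp
  also have "\<dots> \<le> ennreal c * offline_opt M I"
    using assms by (intro mult_right_mono ennreal_leI) auto
  finally show "cost M I \<sigma> \<le> ennreal c * offline_opt M I" .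
qed

theorem theorem2:
  "\<exists>c :: real \<Rightarrow> real.
     c \<in> O[at_right 0](\<lambda>\<epsilon>. 1 / \<epsilon>\<^sup>2) \<and>
     (\<forall>\<epsilon>>0. \<exists>A. speed_competitive A (1 + \<epsilon>) (c \<epsilon>))"
proof -
  \<comment> \<open>The factor \<open>4 * n * (n + 1) * (1 + \<epsilon>)\<close> with
    \<open>n\<close> replaced by its upper bound \<open>2 / \<epsilon> + 1\<close>.\<close>
  let ?c = "\<lambda>\<epsilon>::real. 4 * (2 / \<epsilon> + 1) * (2 / \<epsilon> + 2) * (1 + \<epsilon>)"
  have bigo: "?c \<in> O[at_right 0](\<lambda>\<epsilon>. 1 / \<epsilon>\<^sup>2)"
    by real_asymp
  have "\<exists>A. speed_competitive A (1 + \<epsilon>) (?c \<epsilon>)" if \<epsilon>: "0 < \<epsilon>" for \<epsilon>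
  proof -
    \<comment> \<open>The least exponent with \<open>2 \<le> n * \<epsilon>\<close>, the gap
      condition of the analysis.\<close>
    define n where "n = nat \<lceil>2 / \<epsilon>\<rceil>"
    have n: "2 / \<epsilon> \<le> real n" "real n \<le> 2 / \<epsilon> + 1"
      using \<epsilon> unfolding n_def by (auto simp: of_nat_nat intro: less_imp_le)
    have "0 < 2 / \<epsilon>" using \<epsilon> by simp
    then have "0 < n" using n by (cases n) auto
    have "2 \<le> real n * \<epsilon>" using n \<epsilon> by (simp add: field_simps)
    moreover have "4 * real n * real (Suc n) * (1 + \<epsilon>) \<le> ?c \<epsilon>"
      using n \<epsilon> by (intro mult_mono) auto
    ultimately show ?thesis
      using migrate_competitive[OF \<open>0 < n\<close> _ \<epsilon>] by blast
  qed
  with bigo show ?thesis by blast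
qed

end
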